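(* Let $f(\cdot;i):\mathbb{R}^d\to\mathbb{R}$, $i\in[n]$, be convex and $L$-smooth with a common constant $L>0$, let $F=\frac1n\sum_{i=1}^n f(\cdot;i)$ have a nonempty set of minimizers, let $w_*$ be a minimizer of $F$, and let $\sigma^2:=\frac1n\sum_{i=1}^n\|\nabla f(w_*;i)\|^2$. Fix the number of epochs $T\ge1$ and $0\le\beta<1$, and run the SMG algorithm with momentum parameter $\beta$, the randomized reshuffling strategy, and the constant epoch learning rate $\eta_t:=\eta=\frac{\gamma n^{1/3}}{T^{1/3}}$ for all $t\ge 1$, for some $\gamma>0$ such that $\frac{\gamma n^{1/3}}{T^{1/3}}\le\frac{1}{2L\sqrt{1+\beta}}$. Then the output $\hat w_T$ satisfies $$\mathbb{E}\left[F(\hat w_T)-F(w_* )\right]\le\frac{1}{n^{1/3}T^{2/3}}\left(\frac{\mathbb{E}\left[\|\tilde w_0-w_*\|^2\right]}{2(1-\beta)\gamma}+\frac{4L\sigma^2(1+\beta)\gamma^2}{6(1-\beta)}\right).$$ Consequently, the convergence rate of the algorithm is $\mathcal{O}\left(\frac{1}{n^{1/3}T^{2/3}}\right)$.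
   Context: $[n]:=\{1,\dots,n\}$. $L$-smooth means $\|\nabla f(w;i)-\nabla f(w';i)\|\le L\|w-w'\|$ for all $w,w'\in\mathbb{R}^d$ and all $i\in[n]$. SMG (Shuffling Momentum Gradient) algorithm: choose $\tilde w_0\in\mathbb{R}^d$ and set $\tilde m_0:=\mathbf 0$. For $t=1,\dots,T$: set $w_0^{(t)}:=\tilde w_{t-1}$, $m_0^{(t)}:=\tilde m_{t-1}$, $v_0^{(t)}:=\mathbf 0$; generate a permutation $\pi^{(t)}$ of $[n]$; for $i=0,\dots,n-1$ set $g_i^{(t)}:=\nabla f(w_i^{(t)};\pi^{(t)}(i+1))$, $m_{i+1}^{(t)}:=\beta m_0^{(t)}+(1-\beta)g_i^{(t)}$, $v_{i+1}^{(t)}:=v_i^{(t)}+\frac1n g_i^{(t)}$, $w_{i+1}^{(t)}:=w_i^{(t)}-\frac{\eta_t}{n}m_{i+1}^{(t)}$; then set $\tilde w_t:=w_n^{(t)}$, $\tilde m_t:=v_n^{(t)}$. Output: $\hat w_T\in\{\tilde w_0,\dots,\tilde w_{T-1}\}$ is chosen at random with probability $\mathbb{P}[\hat w_T=\tilde w_{t-1}]=\eta_t/\sum_{s=1}^T\eta_s$ for $t=1,\dots,T$. Randomized reshuffling: at each epoch $t$, $\pi^{(t)}$ is drawn uniformly at random from all permutations of $[n]$, independently of the previous epochs. $\mathbb{E}$ is the total expectation. *)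

theory Defs
  imports "HOL-Probability.Probability"
begin

definition grad :: "('a::euclidean_space \<Rightarrow> real) \<Rightarrow> 'a \<Rightarrow> 'a" where
  "grad f w = (THE D. GDERIV f w :> D)"

definition L_smooth :: "real \<Rightarrow> ('a::euclidean_space \<Rightarrow> real) \<Rightarrow> bool" where
  "L_smooth L f \<longleftrightarrow>
     (\<forall>w. \<exists>D. GDERIV f w :> D) \<and>
     (\<forall>w w'. norm (grad f w - grad f w') \<le> L * norm (w - w'))"

text \<open>The component functions are \<open>f 1, \<dots>, f n\<close>; values of \<open>f\<close> at other indices are irrelevant.\<close>

definition finite_sum_obj :: "nat \<Rightarrow> (nat \<Rightarrow> 'a \<Rightarrow> real) \<Rightarrow> 'a \<Rightarrow> real" where
  "finite_sum_obj n f w = (1 / real n) * (\<Sum>i=1..n. f i w)"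

definition grad_variance :: "nat \<Rightarrow> (nat \<Rightarrow> 'a::euclidean_space \<Rightarrow> real) \<Rightarrow> 'a \<Rightarrow> real" where
  "grad_variance n f wstar = (1 / real n) * (\<Sum>i=1..n. (norm (grad (f i) wstar))\<^sup>2)"

definition minimizes :: "('a \<Rightarrow> real) \<Rightarrow> 'a \<Rightarrow> bool" where
  "minimizes F wstar \<longleftrightarrow> (\<forall>w. F wstar \<le> F w)"

text \<open>\<open>smg_inner n f \<beta> \<eta> p w0 m0 i\<close> is the pair \<open>(w\<^sub>i, v\<^sub>i)\<close> within one epoch that uses learning
  rate \<open>\<eta>\<close> and permutation \<open>p\<close> and starts from \<open>w\<^sub>0 = w0\<close>, \<open>m\<^sub>0 = m0\<close>. The value \<open>m\<^sub>i\<^sub>+\<^sub>1\<close>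
  depends on \<open>m\<^sub>0\<close>, not on \<open>m\<^sub>i\<close>, so it need not be part of the state.\<close>

primrec smg_inner ::
  "nat \<Rightarrow> (nat \<Rightarrow> 'a::euclidean_space \<Rightarrow> real) \<Rightarrow> real \<Rightarrow> real \<Rightarrow> (nat \<Rightarrow> nat) \<Rightarrow> 'a \<Rightarrow> 'a \<Rightarrow> nat \<Rightarrow> 'a \<times> 'a"
where
  "smg_inner n f \<beta> \<eta> p w0 m0 0 = (w0, 0)"
| "smg_inner n f \<beta> \<eta> p w0 m0 (Suc i) =
     (let (w, v) = smg_inner n f \<beta> \<eta> p w0 m0 i;
          g = grad (f (p (i + 1))) w;
          m = \<beta> *\<^sub>R m0 + (1 - \<beta>) *\<^sub>R g
      in (w - (\<eta> / real n) *\<^sub>R m, v + (1 / real n) *\<^sub>R g))"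

text \<open>\<open>smg n f \<beta> \<eta> p w0 t\<close> is the pair of the iterate and the momentum after \<open>t\<close> epochs,
  where epoch \<open>t \<ge> 1\<close> uses learning rate \<open>\<eta> t\<close> and permutation \<open>p t\<close>.\<close>

primrec smg ::
  "nat \<Rightarrow> (nat \<Rightarrow> 'a::euclidean_space \<Rightarrow> real) \<Rightarrow> real \<Rightarrow> (nat \<Rightarrow> real) \<Rightarrow> (nat \<Rightarrow> nat \<Rightarrow> nat) \<Rightarrow> 'a \<Rightarrow> nat \<Rightarrow> 'a \<times> 'a"
where
  "smg n f \<beta> \<eta> p w0 0 = (w0, 0)"
| "smg n f \<beta> \<eta> p w0 (Suc t) =
     (let (w, m) = smg n f \<beta> \<eta> p w0 t
      in smg_inner n f \<beta> (\<eta> (Suc t)) (p (Suc t)) w m n)"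

definition smg_iterate ::
  "nat \<Rightarrow> (nat \<Rightarrow> 'a::euclidean_space \<Rightarrow> real) \<Rightarrow> real \<Rightarrow> (nat \<Rightarrow> real) \<Rightarrow> (nat \<Rightarrow> nat \<Rightarrow> nat) \<Rightarrow> 'a \<Rightarrow> nat \<Rightarrow> 'a"
where
  "smg_iterate n f \<beta> \<eta> p w0 t = fst (smg n f \<beta> \<eta> p w0 t)"

text \<open>The three kinds of randomness: initial point, the permutation of each epoch, and the
  index \<open>t\<close> that selects the output among the iterates. Their values have different types, so
  mutual independence is stated with \<open>indep_sets\<close> on the generated sigma-algebras
  (\<open>indep_vars\<close> requires a common value type).\<close>

datatype rand_source = Init | Perm nat | Out

definition source_events ::
  "'w measure \<Rightarrow> nat \<Rightarrow> nat \<Rightarrow> ('w \<Rightarrow> 'a::euclidean_space) \<Rightarrow> (nat \<Rightarrow> 'w \<Rightarrow> nat \<Rightarrow> nat) \<Rightarrow> ('w \<Rightarrow> nat)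
    \<Rightarrow> rand_source \<Rightarrow> 'w set set"
where
  "source_events M n T W0 \<pi> \<tau> s =
     (case s of
        Init \<Rightarrow> sets (vimage_algebra (space M) W0 borel)
      | Perm t \<Rightarrow> sets (vimage_algebra (space M) (\<pi> t) (count_space {p. p permutes {1..n}}))
      | Out \<Rightarrow> sets (vimage_algebra (space M) \<tau> (count_space {1..T})))"

definition randomized_reshuffling ::
  "'w measure \<Rightarrow> nat \<Rightarrow> nat \<Rightarrow> (nat \<Rightarrow> real) \<Rightarrow> ('w \<Rightarrow> 'a::euclidean_space) \<Rightarrow> (nat \<Rightarrow> 'w \<Rightarrow> nat \<Rightarrow> nat)
    \<Rightarrow> ('w \<Rightarrow> nat) \<Rightarrow> bool"
where
  "randomized_reshuffling M n T \<eta> W0 \<pi> \<tau> \<longleftrightarrow>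
     prob_space M \<and>
     W0 \<in> borel_measurable M \<and>
     (\<forall>t\<in>{1..T}. \<pi> t \<in> measurable M (count_space {p. p permutes {1..n}}) \<and>
        distr M (count_space {p. p permutes {1..n}}) (\<pi> t) = uniform_count_measure {p. p permutes {1..n}}) \<and>
     \<tau> \<in> measurable M (count_space {1..T}) \<and>
     (\<forall>t\<in>{1..T}. measure M {\<omega> \<in> space M. \<tau> \<omega> = t} = \<eta> t / (\<Sum>s=1..T. \<eta> s)) \<and>
     prob_space.indep_sets M (source_events M n T W0 \<pi> \<tau>) ({Init, Out} \<union> Perm ` {1..T})"

definition smg_output ::
  "nat \<Rightarrow> (nat \<Rightarrow> 'a::euclidean_space \<Rightarrow> real) \<Rightarrow> real \<Rightarrow> (nat \<Rightarrow> real) \<Rightarrow> ('w \<Rightarrow> 'a)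
    \<Rightarrow> (nat \<Rightarrow> 'w \<Rightarrow> nat \<Rightarrow> nat) \<Rightarrow> ('w \<Rightarrow> nat) \<Rightarrow> 'w \<Rightarrow> 'a"
where
  "smg_output n f \<beta> \<eta> W0 \<pi> \<tau> \<omega> = smg_iterate n f \<beta> \<eta> (\<lambda>t. \<pi> t \<omega>) (W0 \<omega>) (\<tau> \<omega> - 1)"

definition const_rate :: "real \<Rightarrow> nat \<Rightarrow> nat \<Rightarrow> nat \<Rightarrow> real" where
  "const_rate \<gamma> n T t = \<gamma> * real n powr (1/3) / real T powr (1/3)"

text \<open>Square integrability of the distance of the initial point to \<open>wstar\<close> is included because
  its second moment appears as a real number; the Bochner integral of a non-integrable function is \<open>0\<close>.\<close>

definition smg_rr_setting ::
  "real \<Rightarrow> real \<Rightarrow> real \<Rightarrow> nat \<Rightarrow> nat \<Rightarrow> (nat \<Rightarrow> 'a::euclidean_space \<Rightarrow> real) \<Rightarrow> 'a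
    \<Rightarrow> 'w measure \<Rightarrow> ('w \<Rightarrow> 'a) \<Rightarrow> (nat \<Rightarrow> 'w \<Rightarrow> nat \<Rightarrow> nat) \<Rightarrow> ('w \<Rightarrow> nat) \<Rightarrow> bool"
where
  "smg_rr_setting L \<beta> \<gamma> n T f wstar M W0 \<pi> \<tau> \<longleftrightarrow>
     n \<ge> 1 \<and> T \<ge> 1 \<and>
     (\<forall>i\<in>{1..n}. convex_on UNIV (f i) \<and> L_smooth L (f i)) \<and>
     minimizes (finite_sum_obj n f) wstar \<and>
     \<gamma> * real n powr (1/3) / real T powr (1/3) \<le> 1 / (2 * L * sqrt (1 + \<beta>)) \<and>
     randomized_reshuffling M n T (const_rate \<gamma> n T) W0 \<pi> \<tau> \<and>
     integrable M (\<lambda>\<omega>. (norm (W0 \<omega> - wstar))\<^sup>2)"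

definition smg_gap ::
  "real \<Rightarrow> real \<Rightarrow> nat \<Rightarrow> nat \<Rightarrow> (nat \<Rightarrow> 'a::euclidean_space \<Rightarrow> real) \<Rightarrow> 'a
    \<Rightarrow> ('w \<Rightarrow> 'a) \<Rightarrow> (nat \<Rightarrow> 'w \<Rightarrow> nat \<Rightarrow> nat) \<Rightarrow> ('w \<Rightarrow> nat) \<Rightarrow> 'w \<Rightarrow> real"
where
  "smg_gap \<beta> \<gamma> n T f wstar W0 \<pi> \<tau> \<omega> =
     finite_sum_obj n f (smg_output n f \<beta> (const_rate \<gamma> n T) W0 \<pi> \<tau> \<omega>) - finite_sum_obj n f wstar"

end

theory Submission
  imports Defs
begin

text \<open>The proof rests on a change of variables that removes the momentum. With \<open>w t\<close> and \<open>m t\<close> the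
  iterate and the momentum after \<open>t\<close> epochs, the auxiliary points \<open>z t = w t - (\<eta> * \<beta>) * m t\<close>
  satisfy \<open>z (t+1) = z t - \<eta> * m (t+1)\<close>, that is, they perform plain gradient steps in which the
  full gradient is replaced by the mean \<open>m (t+1)\<close> of the component gradients met during the epoch.
  Moreover \<open>w (t+1) = \<beta> * z t + (1 - \<beta>) * z (t+1)\<close>, so by convexity a bound on the function
  values at the points \<open>z t\<close> is one on those at the iterates, up to a factor \<open>1 / (1 - \<beta>)\<close>.

  For a plain step one expands the squared distance to the minimizer. The component gradients are
  evaluated at the inner iterates and not at \<open>z t\<close>; by convexity and smoothness
  (\<open>three_point_inequality\<close>) this error is the squared drift of the inner iterates from \<open>z t\<close>. The
  drift is a convex combination of a momentum part and a sum of gradients already met in the epoch.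
  Replacing these gradients by those at the minimizer costs terms that the three-point inequality
  pays for, and leaves partial sums of the gradients at the minimizer in the order of the
  permutation. The result is \<open>epoch_inequality\<close>: the potential consisting of the squared distance to
  the minimizer and a small multiple of the squared momentum decreases by the gap at \<open>z t\<close>, up to
  the \<open>shuffling_noise\<close> of the permutation. It holds for each permutation, so \<open>sum_gap_le\<close> telescopes
  it along every single run.

  Randomness enters only afterwards. The gradients at the minimizer sum to zero, so sampling them
  without replacement produces negatively correlated vectors, and a partial sum of \<open>i\<close> of them has
  mean square at most \<open>i\<close> times their variance. The mean shuffling noise is therefore of order
  \<open>\<sigma>\<^sup>2 / n\<close> (\<open>shuffling_noise_average\<close>). The output index is independent of the run and uniform,
  because the learning rate is constant, so the expected gap at the output is the mean of the
  expected gaps at the iterates (\<open>expected_gap_le\<close>).\<close>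

section \<open>Smooth convex functions\<close>

lemma GDERIV_unique:
  fixes D D' :: "'a::real_inner"
  assumes "GDERIV f x :> D" "GDERIV f x :> D'"
  shows "D = D'"
proof -
  have "(\<lambda>h. h \<bullet> D) = (\<lambda>h. h \<bullet> D')"
    using assms unfolding gderiv_def by (rule has_derivative_unique)
  then have "\<And>h. h \<bullet> (D - D') = 0"
    by (metis inner_diff_right right_minus_eq)
  then show ?thesis
    by (metis inner_eq_zero_iff right_minus_eq)
qed

lemma L_smooth_lipschitz:
  "L_smooth L f \<Longrightarrow> norm (grad f x - grad f y) \<le> L * norm (x - y)"
  by (simp add: L_smooth_def)

lemma GDERIV_grad:
  assumes "L_smooth L f"
  shows "GDERIV f w :> grad f w"
proof -
  obtain D where D: "GDERIV f w :> D"
    using assms unfolding L_smooth_def by blast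
  then have "grad f w = D"
    unfolding grad_def by (blast intro: GDERIV_unique)
  with D show ?thesis by simp
qed

lemma continuous_on_grad:
  assumes "L_smooth L f"
  shows "continuous_on UNIV (grad f)"
proof -
  have "L \<ge> 0"
  proof -
    obtain b :: 'a where "b \<in> Basis" using nonempty_Basis by blast
    then have "norm (b - 0) = 1" by simp
    moreover have "norm (grad f b - grad f 0) \<le> L * norm (b - 0)"
      by (rule L_smooth_lipschitz[OF assms])
    ultimately show ?thesis by (simp add: order_trans[OF norm_ge_zero])
  qed
  then have "L-lipschitz_on UNIV (grad f)"
    using L_smooth_lipschitz[OF assms] by (auto simp: lipschitz_on_def dist_norm)
  then show ?thesis by (rule lipschitz_on_continuous_on)
qed

lemma GDERIV_along_line:
  assumes "GDERIV f (y + t *\<^sub>R d) :> D"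
  shows "((\<lambda>s. f (y + s *\<^sub>R d)) has_real_derivative D \<bullet> d) (at t)"
proof -
  have "((\<lambda>s. f (y + s *\<^sub>R d)) has_derivative (\<lambda>h. (h *\<^sub>R d) \<bullet> D)) (at t)"
  proof (rule has_derivative_compose[where g = f])
    show "((\<lambda>s. y + s *\<^sub>R d) has_derivative (\<lambda>h. h *\<^sub>R d)) (at t)"
      by (auto intro!: derivative_eq_intros)
    show "(f has_derivative (\<lambda>h. h \<bullet> D)) (at (y + t *\<^sub>R d))"
      using assms unfolding gderiv_def .
  qed
  then show ?thesis
    by (rule has_derivative_imp_has_field_derivative) (simp add: inner_commute)
qed

lemma convex_above_gradient:
  assumes "convex_on UNIV f" and "GDERIV f y :> D"
  shows "f x \<ge> f y + D \<bullet> (x - y)"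
proof -
  define \<phi> where "\<phi> s = f (y + s *\<^sub>R (x - y))" for s
  have "convex_on UNIV \<phi>"
  proof (rule convex_onI)
    fix t a b :: real assume t: "0 < t" "t < 1"
    have "y + ((1 - t) *\<^sub>R a + t *\<^sub>R b) *\<^sub>R (x - y)
        = (1 - t) *\<^sub>R (y + a *\<^sub>R (x - y)) + t *\<^sub>R (y + b *\<^sub>R (x - y))"
      by (simp add: algebra_simps)
    then show "\<phi> ((1 - t) *\<^sub>R a + t *\<^sub>R b) \<le> (1 - t) * \<phi> a + t * \<phi> b"
      unfolding \<phi>_def using convex_onD[OF assms(1), of t] t by simp
  qed simp
  moreover have "(\<phi> has_real_derivative D \<bullet> (x - y)) (at 0)"
    unfolding \<phi>_def by (rule GDERIV_along_line) (use assms(2) in simp)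
  ultimately have "\<phi> 1 - \<phi> 0 \<ge> D \<bullet> (x - y) * (1 - 0)"
    by (intro convex_on_imp_above_tangent[where A = UNIV]) auto
  then show ?thesis by (simp add: \<phi>_def)
qed

text \<open>The difference between \<open>f\<close> and its quadratic upper model, taken without the constant \<open>f y\<close>, along the segment from \<open>y\<close> to \<open>x\<close>
  has derivative at most \<open>0\<close> there, by the Lipschitz bound on the gradient, and it starts at
  the value \<open>f y\<close>.\<close>

lemma L_smooth_upper_bound:
  assumes "L_smooth L f"
  shows "f x \<le> f y + grad f y \<bullet> (x - y) + L / 2 * (norm (x - y))\<^sup>2"
proof -
  define d where "d = x - y"
  define \<psi> where "\<psi> s = f (y + s *\<^sub>R d) - s * (grad f y \<bullet> d) - L / 2 * s\<^sup>2 * (norm d)\<^sup>2" for s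
  have "\<psi> 1 \<le> \<psi> 0"
  proof (rule DERIV_nonpos_imp_nonincreasing[of 0 1 \<psi>])
    fix s :: real assume s: "0 \<le> s" "s \<le> 1"
    let ?D = "grad f (y + s *\<^sub>R d) \<bullet> d - grad f y \<bullet> d - L * s * (norm d)\<^sup>2"
    have "((\<lambda>s. f (y + s *\<^sub>R d)) has_real_derivative grad f (y + s *\<^sub>R d) \<bullet> d) (at s)"
      by (intro GDERIV_along_line GDERIV_grad[OF assms])
    then have "(\<psi> has_real_derivative ?D) (at s)"
      unfolding \<psi>_def by - ((rule derivative_eq_intros refl | assumption)+, simp)
    moreover have "?D \<le> 0"
    proof -
      have "(grad f (y + s *\<^sub>R d) - grad f y) \<bullet> d
          \<le> norm (grad f (y + s *\<^sub>R d) - grad f y) * norm d"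
        by (rule norm_cauchy_schwarz)
      also have "\<dots> \<le> (L * norm (y + s *\<^sub>R d - y)) * norm d"
        by (intro mult_right_mono L_smooth_lipschitz[OF assms]) simp
      also have "\<dots> = L * s * (norm d)\<^sup>2"
        using s by (simp add: power2_eq_square)
      finally show ?thesis by (simp add: inner_diff_left)
    qed
    ultimately show "\<exists>y. (\<psi> has_real_derivative y) (at s) \<and> y \<le> 0" by blast
  qed simp
  then show ?thesis by (simp add: \<psi>_def d_def)
qed

text \<open>A gradient step of length \<open>1 / L\<close> from \<open>x\<close> on the function \<open>f - (grad f y \<bullet> _)\<close>, which is minimal at
  \<open>y\<close>, decreases it by at least the squared norm of its gradient divided by \<open>2 * L\<close>; the end
  point of this step is \<open>u\<close>.\<close>

lemma convex_L_smooth_lower_bound: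
  assumes "convex_on UNIV f" and "L_smooth L f" and "L > 0"
  shows "f x \<ge> f y + grad f y \<bullet> (x - y) + (norm (grad f x - grad f y))\<^sup>2 / (2 * L)"
proof -
  define q where "q = grad f x - grad f y"
  define u where "u = x - (1 / L) *\<^sub>R q"
  have qq: "grad f x \<bullet> q = grad f y \<bullet> q + (norm q)\<^sup>2"
    by (simp add: q_def power2_norm_eq_inner inner_diff_left inner_diff_right inner_commute)
  have "f u \<ge> f y + grad f y \<bullet> (u - y)"
    using assms by (intro convex_above_gradient GDERIV_grad)
  moreover have "f u \<le> f x + grad f x \<bullet> (u - x) + L / 2 * (norm (u - x))\<^sup>2"
    using assms by (intro L_smooth_upper_bound)
  moreover have "L / 2 * (norm (u - x))\<^sup>2 = (norm q)\<^sup>2 / (2 * L)"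
    using assms(3) by (simp add: u_def power2_eq_square field_simps)
  moreover have "grad f x \<bullet> (u - x) = - ((grad f y \<bullet> q) / L) - (norm q)\<^sup>2 / L"
    using qq by (simp add: u_def add_divide_distrib diff_divide_distrib)
  moreover have "grad f y \<bullet> (u - y) = grad f y \<bullet> (x - y) - (grad f y \<bullet> q) / L"
    by (simp add: u_def inner_diff_right)
  moreover have "(norm q)\<^sup>2 / L = (norm q)\<^sup>2 / (2 * L) + (norm q)\<^sup>2 / (2 * L)"
    by simp
  ultimately show ?thesis unfolding q_def[symmetric] by linarith
qed

text \<open>This lets a gradient taken at \<open>x\<close> be charged to the function values at another point \<open>z\<close>. The
  quadratic term in \<open>x - z\<close> is the price, and the squared gradient difference is a reserve that later
  pays for every term caused by the algorithm's gradients differing from those at the minimizer.\<close>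

lemma three_point_inequality:
  assumes "convex_on UNIV f" and "L_smooth L f" and "L > 0"
  shows "grad f x \<bullet> (z - y) \<ge> f z - f y + (norm (grad f x - grad f y))\<^sup>2 / (2 * L)
           - L / 2 * (norm (x - z))\<^sup>2"
proof -
  have "grad f x \<bullet> (z - y) = grad f x \<bullet> (z - x) - grad f x \<bullet> (y - x)"
    by (simp add: inner_diff_right)
  moreover have "f z \<le> f x + grad f x \<bullet> (z - x) + L / 2 * (norm (z - x))\<^sup>2"
    using assms by (intro L_smooth_upper_bound)
  moreover have "f y \<ge> f x + grad f x \<bullet> (y - x) + (norm (grad f y - grad f x))\<^sup>2 / (2 * L)"
    using assms by (intro convex_L_smooth_lower_bound)
  ultimately show ?thesis by (simp add: norm_minus_commute)
qed

lemma sum_grad_minimizer: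
  fixes f :: "nat \<Rightarrow> 'a::euclidean_space \<Rightarrow> real"
  assumes "n \<ge> 1" and "\<And>i. i \<in> {1..n} \<Longrightarrow> L_smooth L (f i)"
    and "minimizes (finite_sum_obj n f) w"
  shows "(\<Sum>i=1..n. grad (f i) w) = 0"
proof -
  define D where "D = (\<Sum>i=1..n. grad (f i) w)"
  have "((\<lambda>x. \<Sum>i=1..n. f i x) has_derivative (\<lambda>h. \<Sum>i=1..n. h \<bullet> grad (f i) w)) (at w)"
  proof (rule has_derivative_sum)
    fix i assume "i \<in> {1..n}"
    from GDERIV_grad[OF assms(2)[OF this]]
    show "(f i has_derivative (\<lambda>h. h \<bullet> grad (f i) w)) (at w)"
      unfolding gderiv_def .
  qed
  then have der: "((\<lambda>x. \<Sum>i=1..n. f i x) has_derivative (\<lambda>h. h \<bullet> D)) (at w)"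
    unfolding D_def inner_sum_right .
  have min: "(\<Sum>i=1..n. f i w) \<le> (\<Sum>i=1..n. f i x)" for x
  proof -
    have "(1 / real n) * (\<Sum>i=1..n. f i w) \<le> (1 / real n) * (\<Sum>i=1..n. f i x)"
      using assms(3) unfolding minimizes_def finite_sum_obj_def by blast
    moreover have "1 / real n > 0" using assms(1) by simp
    ultimately show ?thesis
      using mult_le_cancel_left_pos by blast
  qed
  have "(\<lambda>h. h \<bullet> D) = (\<lambda>h. 0)"
    by (rule differential_zero_maxmin[OF _ _ der, of UNIV]) (use min in auto)
  then have "D \<bullet> D = 0" by (rule fun_cong[of _ _ D])
  then have "D = 0" by simp
  then show ?thesis unfolding D_def .
qed

section \<open>Partial sums of samples drawn without replacement\<close>

lemma norm_sum_squared_le: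
  fixes v :: "'i \<Rightarrow> 'a::real_normed_vector"
  shows "(norm (\<Sum>i\<in>I. v i))\<^sup>2 \<le> real (card I) * (\<Sum>i\<in>I. (norm (v i))\<^sup>2)"
proof -
  have "(norm (\<Sum>i\<in>I. v i))\<^sup>2 \<le> (\<Sum>i\<in>I. norm (v i))\<^sup>2"
    by (intro power_mono norm_sum norm_ge_zero)
  also have "\<dots> \<le> (\<Sum>i\<in>I. (norm (v i))\<^sup>2) * real (card I)"
    by (rule sum_squared_le_sum_of_squares)
  finally show ?thesis by (simp add: mult.commute)
qed

lemma norm_add_squared_le:
  fixes a b :: "'a::real_normed_vector"
  shows "(norm (a + b))\<^sup>2 \<le> 2 * (norm a)\<^sup>2 + 2 * (norm b)\<^sup>2"
proof -
  have "(norm (a + b))\<^sup>2 \<le> (norm a + norm b)\<^sup>2"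
    by (intro power_mono norm_triangle_ineq norm_ge_zero)
  also have "\<dots> \<le> 2 * (norm a)\<^sup>2 + 2 * (norm b)\<^sup>2"
    using sum_squares_bound[of "norm a" "norm b"] by (simp add: power2_sum)
  finally show ?thesis .
qed

lemma sum_lessThan_real_le: "(\<Sum>i<n. real i) \<le> (real n)\<^sup>2 / 2"
  by (induction n) (auto simp: power2_eq_square field_simps)

lemma norm_convex_combination_squared_le:
  fixes a b :: "'a::real_inner"
  assumes "0 \<le> t" "t \<le> 1"
  shows "(norm (t *\<^sub>R a + (1 - t) *\<^sub>R b))\<^sup>2 \<le> t * (norm a)\<^sup>2 + (1 - t) * (norm b)\<^sup>2"
proof -
  have "t * (norm a)\<^sup>2 + (1 - t) * (norm b)\<^sup>2 - (norm (t *\<^sub>R a + (1 - t) *\<^sub>R b))\<^sup>2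
      = t * (1 - t) * (norm (a - b))\<^sup>2"
    unfolding power2_norm_eq_inner
    by (simp add: inner_add_left inner_add_right inner_diff_left inner_diff_right inner_commute
        algebra_simps)
  also have "\<dots> \<ge> 0" using assms by simp
  finally show ?thesis by simp
qed

text \<open>Reindexing by \<open>p \<mapsto> p \<circ> transpose j k\<close> shows that all positions of a random permutation
  are exchangeable.\<close>

lemma sum_over_permutations_swap:
  assumes "finite S" "j \<in> S" "k \<in> S"
  shows "(\<Sum>p | p permutes S. h p) = (\<Sum>p | p permutes S. h (p \<circ> Transposition.transpose j k))"
  by (rule sum_permutations_compose_right) (use assms in \<open>simp add: permutes_swap_id\<close>)

text \<open>Two draws without replacement from vectors that sum to zero are negatively correlated. By
  exchangeability the cross moment is the same for every \<open>k \<noteq> j\<close>, and adding all of these to the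
  second moment of position \<open>j\<close> gives the inner product with the total sum, which is zero.\<close>

lemma permutation_cross_moment_nonpos:
  fixes a :: "'b \<Rightarrow> 'a::real_inner"
  assumes S: "finite S" and zero: "(\<Sum>i\<in>S. a i) = 0"
    and jk: "j \<in> S" "k \<in> S" "j \<noteq> k"
  shows "(\<Sum>p | p permutes S. a (p j) \<bullet> a (p k)) \<le> 0"
proof -
  define c where "c k = (\<Sum>p | p permutes S. a (p j) \<bullet> a (p k))" for k
  have const: "c k' = c k" if "k' \<in> S - {j}" for k'
    unfolding c_def
    by (subst sum_over_permutations_swap[OF S jk(2), of k'])
       (use that jk in \<open>auto simp: Transposition.transpose_def intro!: sum.cong\<close>)
  have "(\<Sum>k\<in>S. c k) = (\<Sum>p | p permutes S. a (p j) \<bullet> (\<Sum>k\<in>S. a (p k)))"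
    unfolding c_def inner_sum_right by (rule sum.swap)
  also have "\<dots> = (\<Sum>p | p permutes S. 0)"
  proof (rule sum.cong)
    fix p assume "p \<in> {p. p permutes S}"
    then have "(\<Sum>k\<in>S. a (p k)) = (\<Sum>k\<in>S. a k)"
      using sum.permute[of p S a] by (simp add: o_def)
    then show "a (p j) \<bullet> (\<Sum>k\<in>S. a (p k)) = 0" using zero by simp
  qed simp
  finally have "(\<Sum>k\<in>S. c k) = 0" by simp
  moreover have "(\<Sum>k\<in>S. c k) = c j + (\<Sum>k'\<in>S - {j}. c k')"
    using S jk by (simp add: sum.remove)
  moreover have "(\<Sum>k'\<in>S - {j}. c k') = real (card (S - {j})) * c k"
    using const by simp
  moreover have "c j \<ge> 0" unfolding c_def by (intro sum_nonneg) simp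
  \<comment> \<open>The case \<open>k' = j\<close> of the family \<open>c\<close> is the
    nonnegative second moment.\<close>
  ultimately have "real (card (S - {j})) * c k \<le> 0" by simp
  moreover have "card (S - {j}) > 0" unfolding card_gt_0_iff using S jk by blast
  ultimately have "c k \<le> 0" by (simp add: mult_le_0_iff)
  then show ?thesis by (simp add: c_def)
qed

lemma permutation_second_moment:
  fixes h :: "'b \<Rightarrow> real"
  assumes S: "finite S" and "j \<in> S"
  shows "real (card S) * (\<Sum>p | p permutes S. h (p j)) = fact (card S) * (\<Sum>i\<in>S. h i)"
proof -
  have "real (card S) * (\<Sum>p | p permutes S. h (p j)) = (\<Sum>k\<in>S. \<Sum>p | p permutes S. h (p j))"
    by simp
  also have "\<dots> = (\<Sum>k\<in>S. \<Sum>p | p permutes S. h (p k))"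
  proof (rule sum.cong)
    fix k assume "k \<in> S"
    show "(\<Sum>p | p permutes S. h (p j)) = (\<Sum>p | p permutes S. h (p k))"
      by (subst sum_over_permutations_swap[OF S \<open>j \<in> S\<close> \<open>k \<in> S\<close>]) simp
  qed simp
  also have "\<dots> = (\<Sum>p | p permutes S. \<Sum>k\<in>S. h (p k))"
    by (rule sum.swap)
  also have "\<dots> = (\<Sum>p | p permutes S. \<Sum>k\<in>S. h k)"
  proof (rule sum.cong)
    fix p assume "p \<in> {p. p permutes S}"
    then show "(\<Sum>k\<in>S. h (p k)) = (\<Sum>k\<in>S. h k)"
      using sum.permute[of p S h] by (simp add: o_def)
  qed simp
  also have "\<dots> = fact (card S) * (\<Sum>i\<in>S. h i)"
    using card_permutations[OF refl S] by simp
  finally show ?thesis .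
qed

text \<open>In the expanded square the cross terms are nonpositive, so that only the second moments of the
  \<open>card J\<close> single draws remain.\<close>

lemma partial_sum_second_moment:
  fixes a :: "'b \<Rightarrow> 'a::real_inner"
  assumes S: "finite S" and zero: "(\<Sum>i\<in>S. a i) = 0" and J: "J \<subseteq> S"
  shows "real (card S) * (\<Sum>p | p permutes S. (norm (\<Sum>j\<in>J. a (p j)))\<^sup>2)
         \<le> real (card J) * (fact (card S) * (\<Sum>i\<in>S. (norm (a i))\<^sup>2))"
proof -
  have finJ: "finite J" using S J by (rule rev_finite_subset)
  have "(\<Sum>p | p permutes S. (norm (\<Sum>j\<in>J. a (p j)))\<^sup>2)
      = (\<Sum>p | p permutes S. \<Sum>j\<in>J. \<Sum>k\<in>J. a (p j) \<bullet> a (p k))"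
    by (simp add: power2_norm_eq_inner inner_sum_left inner_sum_right)
       (intro sum.cong refl inner_commute)
  also have "\<dots> = (\<Sum>j\<in>J. \<Sum>p | p permutes S. \<Sum>k\<in>J. a (p j) \<bullet> a (p k))"
    by (rule sum.swap)
  also have "\<dots> = (\<Sum>j\<in>J. \<Sum>k\<in>J. \<Sum>p | p permutes S. a (p j) \<bullet> a (p k))"
    by (intro sum.cong refl sum.swap)
  also have "\<dots> \<le> (\<Sum>j\<in>J. \<Sum>p | p permutes S. (norm (a (p j)))\<^sup>2)"
  proof (rule sum_mono)
    fix j assume j: "j \<in> J"
    have "(\<Sum>k\<in>J. \<Sum>p | p permutes S. a (p j) \<bullet> a (p k))
        = (\<Sum>p | p permutes S. a (p j) \<bullet> a (p j))
          + (\<Sum>k\<in>J - {j}. \<Sum>p | p permutes S. a (p j) \<bullet> a (p k))"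
      using finJ j by (simp add: sum.remove)
    also have "(\<Sum>k\<in>J - {j}. \<Sum>p | p permutes S. a (p j) \<bullet> a (p k)) \<le> 0"
      by (rule sum_nonpos, rule permutation_cross_moment_nonpos[OF S zero]) (use j J in auto)
    finally show "(\<Sum>k\<in>J. \<Sum>p | p permutes S. a (p j) \<bullet> a (p k))
        \<le> (\<Sum>p | p permutes S. (norm (a (p j)))\<^sup>2)"
      by (simp add: power2_norm_eq_inner)
  qed
  finally have "real (card S) * (\<Sum>p | p permutes S. (norm (\<Sum>j\<in>J. a (p j)))\<^sup>2)
      \<le> real (card S) * (\<Sum>j\<in>J. \<Sum>p | p permutes S. (norm (a (p j)))\<^sup>2)"
    by (intro mult_left_mono) auto
  also have "\<dots> = (\<Sum>j\<in>J. fact (card S) * (\<Sum>i\<in>S. (norm (a i))\<^sup>2))"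
    by (subst sum_distrib_left,
        intro sum.cong refl permutation_second_moment[OF S, of _ "\<lambda>i. (norm (a i))\<^sup>2"])
       (use J in auto)
  finally show ?thesis by simp
qed

text \<open>This is the average over the inner steps \<open>i < n\<close> of the squared norm of the partial sum
  \<open>(1 / n) * (a (p 1) + \<dots> + a (p i))\<close>. With \<open>a\<close> the component gradients at the minimizer, it measures
  what the order of the samples contributes to the drift of the iterates within an epoch.\<close>

definition shuffling_noise :: "nat \<Rightarrow> (nat \<Rightarrow> 'a::real_normed_vector) \<Rightarrow> (nat \<Rightarrow> nat) \<Rightarrow> real" where
  "shuffling_noise n a p = (\<Sum>i<n. (norm (\<Sum>j<i. a (p (Suc j))))\<^sup>2) / real n ^ 3"

text \<open>The partial sum of length \<open>i\<close> has mean square at most \<open>i\<close> times the variance, and the lengths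
  \<open>i < n\<close> add up to at most \<open>n\<^sup>2 / 2\<close>. The remaining factor \<open>1 / n\<close> is the gain of reshuffling
  over an arbitrary order.\<close>

lemma shuffling_noise_average:
  fixes a :: "nat \<Rightarrow> 'a::real_inner"
  assumes n: "n \<ge> 1" and zero: "(\<Sum>i=1..n. a i) = 0"
  shows "(\<Sum>p | p permutes {1..n}. shuffling_noise n a p) / fact n
         \<le> ((\<Sum>i=1..n. (norm (a i))\<^sup>2) / real n) / (2 * real n)"
proof -
  define A where "A = (\<Sum>i=1..n. (norm (a i))\<^sup>2)"
  have A: "A \<ge> 0" unfolding A_def by (intro sum_nonneg) simp
  have npos: "real n > 0" using n by simp
  have bound: "(\<Sum>p | p permutes {1..n}. (norm (\<Sum>j<i. a (p (Suc j))))\<^sup>2)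
      \<le> real i * (fact n * A) / real n" if "i < n" for i
  proof -
    have "(\<Sum>j<i. a (p (Suc j))) = (\<Sum>j\<in>{1..i}. a (p j))" for p
      by (simp add: sum.atLeast1_atMost_eq)
    then show ?thesis
      using partial_sum_second_moment[OF _ zero, of "{1..i}"] that npos
      by (simp add: A_def field_simps)
  qed
  have "(\<Sum>p | p permutes {1..n}. shuffling_noise n a p)
      = (\<Sum>i<n. \<Sum>p | p permutes {1..n}. (norm (\<Sum>j<i. a (p (Suc j))))\<^sup>2) / real n ^ 3"
    unfolding shuffling_noise_def sum_divide_distrib[symmetric] by (subst sum.swap) (rule refl)
  also have "\<dots> \<le> (\<Sum>i<n. real i * (fact n * A) / real n) / real n ^ 3"
    using bound by (intro divide_right_mono sum_mono) auto
  also have "\<dots> = (\<Sum>i<n. real i) * (fact n * A) / real n ^ 4"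
    by (simp add: sum_distrib_right sum_divide_distrib power_numeral_reduce)
  also have "\<dots> \<le> ((real n)\<^sup>2 / 2) * (fact n * A) / real n ^ 4"
  proof -
    have "(\<Sum>i<n. real i) \<le> (real n)\<^sup>2 / 2" by (rule sum_lessThan_real_le)
    then show ?thesis using A by (intro divide_right_mono mult_right_mono) auto
  qed
  also have "\<dots> = fact n * (A / real n / (2 * real n))"
    using npos by (simp add: field_simps power_numeral_reduce)
  finally show ?thesis unfolding A_def[symmetric]
    by (subst pos_divide_le_eq) (simp_all add: mult.commute)
qed

section \<open>Independence of the output index\<close>

text \<open>The sigma-algebra of everything that the iterates depend on: the initial point and the
  permutations of all epochs, but not the index that selects the output.\<close>

definition input_algebra ::
  "'w measure \<Rightarrow> nat \<Rightarrow> nat \<Rightarrow> ('w \<Rightarrow> 'a::euclidean_space) \<Rightarrow> (nat \<Rightarrow> 'w \<Rightarrow> nat \<Rightarrow> nat) \<Rightarrow> 'w measure"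
where
  "input_algebra M n T W0 \<pi> = sigma (space M)
     (sets (vimage_algebra (space M) W0 borel) \<union>
      (\<Union>t\<in>{1..T}. sets (vimage_algebra (space M) (\<pi> t) (count_space {p. p permutes {1..n}}))))"

lemma space_input_algebra [simp]: "space (input_algebra M n T W0 \<pi>) = space M"
  by (simp add: input_algebra_def space_measure_of_conv)

lemma sets_input_algebra:
  "sets (input_algebra M n T W0 \<pi>) = sigma_sets (space M)
     (sets (vimage_algebra (space M) W0 borel) \<union>
      (\<Union>t\<in>{1..T}. sets (vimage_algebra (space M) (\<pi> t) (count_space {p. p permutes {1..n}}))))"
proof -
  have "sets (vimage_algebra (space M) W0 borel) \<subseteq> Pow (space M)"
    and "\<And>t. sets (vimage_algebra (space M) (\<pi> t) (count_space {p. p permutes {1..n}})) \<subseteq> Pow (space M)"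
    by (metis sets.space_closed space_vimage_algebra)+
  then show ?thesis
    unfolding input_algebra_def by (intro sets_measure_of) blast
qed

lemma measurable_input_init:
  fixes W0 :: "'w \<Rightarrow> 'a::euclidean_space"
  shows "W0 \<in> borel_measurable (input_algebra M n T W0 \<pi>)"
proof (rule measurableI)
  fix A :: "'a set" assume "A \<in> sets borel"
  then have "W0 -` A \<inter> space M \<in> sets (vimage_algebra (space M) W0 borel)"
    by (rule in_vimage_algebra)
  then show "W0 -` A \<inter> space (input_algebra M n T W0 \<pi>) \<in> sets (input_algebra M n T W0 \<pi>)"
    unfolding sets_input_algebra by (auto intro: sigma_sets.Basic)
qed simp

lemma measurable_input_perm:
  assumes "t \<in> {1..T}" and "\<pi> t \<in> space M \<rightarrow> {p. p permutes {1..n}}"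
  shows "\<pi> t \<in> measurable (input_algebra M n T W0 \<pi>) (count_space {p. p permutes {1..n}})"
proof (rule measurableI)
  fix A assume "A \<in> sets (count_space {p. p permutes {1..n}})"
  then have "\<pi> t -` A \<inter> space M
      \<in> sets (vimage_algebra (space M) (\<pi> t) (count_space {p. p permutes {1..n}}))"
    by (rule in_vimage_algebra)
  then show "\<pi> t -` A \<inter> space (input_algebra M n T W0 \<pi>) \<in> sets (input_algebra M n T W0 \<pi>)"
    unfolding sets_input_algebra space_input_algebra using assms(1)
    by (intro sigma_sets.Basic UnI2 UN_I)
qed (use assms(2) in auto)

text \<open>The sources are grouped into two blocks, \<open>Out\<close> alone and all the others; independence of the
  sources passes to the sigma-algebras generated by the blocks.\<close>

lemma output_independent_of_input:
  assumes rr: "randomized_reshuffling M n T \<eta>s W0 \<pi> \<tau>"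
  shows "prob_space.indep_set M (sets (input_algebra M n T W0 \<pi>))
           (sets (vimage_algebra (space M) \<tau> (count_space {1..T})))"
proof -
  interpret prob_space M using rr by (simp add: randomized_reshuffling_def)
  define E where "E = source_events M n T W0 \<pi> \<tau>"
  define I where "I = case_bool (insert Init (Perm ` {1..T})) {Out}"
  have "indep_sets E ({Init, Out} \<union> Perm ` {1..T})"
    using rr by (simp add: randomized_reshuffling_def E_def)
  also have "{Init, Out} \<union> Perm ` {1..T} = (\<Union>b\<in>UNIV. I b)"
    by (auto simp: I_def UNIV_bool)
  finally have indep: "indep_sets (\<lambda>b. sigma_sets (space M) (\<Union>s\<in>I b. E s)) UNIV"
  proof (rule indep_sets_collect_sigma)
    show "Int_stable (E s)" for s
      by (cases s) (simp_all add: E_def source_events_def sets.Int_stable)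
    show "disjoint_family_on I UNIV"
      by (auto simp: disjoint_family_on_def I_def split: bool.splits)
  qed
  have "(\<Union>s\<in>I True. E s) = sets (vimage_algebra (space M) W0 borel) \<union>
      (\<Union>t\<in>{1..T}. sets (vimage_algebra (space M) (\<pi> t) (count_space {p. p permutes {1..n}})))"
    by (simp add: I_def E_def source_events_def)
  then have input_block: "sigma_sets (space M) (\<Union>s\<in>I True. E s) = sets (input_algebra M n T W0 \<pi>)"
    by (simp add: sets_input_algebra)
  have output_block: "(\<Union>s\<in>I False. E s) = sets (vimage_algebra (space M) \<tau> (count_space {1..T}))"
    by (simp add: I_def E_def source_events_def)
  show ?thesis
    unfolding indep_set_def
    by (rule indep_sets_mono_sets[OF indep])
       (auto simp: input_block output_block split: bool.splits intro: sigma_sets.Basic)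
qed

text \<open>Selecting the output at random and independently turns the expectation of a quantity at the
  selected iterate into the weighted mean of its expectations at the single iterates.\<close>

lemma expectation_output_indicator:
  fixes X :: "'w \<Rightarrow> real"
  assumes rr: "randomized_reshuffling M n T \<eta>s W0 \<pi> \<tau>"
    and X: "X \<in> borel_measurable (input_algebra M n T W0 \<pi>)" and int: "integrable M X"
    and t: "t \<in> {1..T}"
  shows "integrable M (\<lambda>\<omega>. X \<omega> * indicator {t} (\<tau> \<omega>))"
    and "(LINT \<omega>|M. X \<omega> * indicator {t} (\<tau> \<omega>)) = (LINT \<omega>|M. X \<omega>) * (\<eta>s t / (\<Sum>s=1..T. \<eta>s s))"
proof -
  interpret prob_space M using rr by (simp add: randomized_reshuffling_def)
  define Y :: "'w \<Rightarrow> real" where "Y \<omega> = indicator {t} (\<tau> \<omega>)" for \<omega>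
  have \<tau>: "\<tau> \<in> measurable M (count_space {1..T})"
    using rr by (simp add: randomized_reshuffling_def)
  have Ymeas: "Y \<in> borel_measurable N" if "\<tau> \<in> measurable N (count_space {1..T})" for N
    unfolding Y_def by (rule measurable_compose[OF that]) simp
  have YM: "Y \<in> borel_measurable M" by (rule Ymeas[OF \<tau>])
  have YO: "Y \<in> borel_measurable (vimage_algebra (space M) \<tau> (count_space {1..T}))"
    using measurable_space[OF \<tau>] by (intro Ymeas measurable_vimage_algebra1) auto
  have "indep_var borel X borel Y"
    unfolding indep_var_eq indep_set_def
  proof (intro conjI)
    show "random_variable borel X" using int by simp
    show "random_variable borel Y" by (rule YM)
    have sub: "sigma_sets (space M) {h -` A \<inter> space M |A. A \<in> sets borel} \<subseteq> sets N"
      if "space N = space M" "h \<in> borel_measurable N" for N and h :: "'w \<Rightarrow> real"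
    proof -
      have "{h -` A \<inter> space M |A. A \<in> sets borel} \<subseteq> sets N"
        using that(1) measurable_sets[OF that(2)] by auto
      then show ?thesis
        unfolding that(1)[symmetric] by (rule sets.sigma_sets_subset)
    qed
    show "indep_sets (case_bool
        (sigma_sets (space M) {X -` A \<inter> space M |A. A \<in> sets borel})
        (sigma_sets (space M) {Y -` A \<inter> space M |A. A \<in> sets borel})) UNIV"
      by (rule indep_sets_mono_sets[OF output_independent_of_input[OF rr, unfolded indep_set_def]])
         (use sub[OF _ X] sub[OF _ YO] in \<open>auto split: bool.splits\<close>)
  qed
  moreover have "integrable M Y"
    by (rule integrable_const_bound[where B = 1, OF _ YM]) (simp add: Y_def indicator_def)
  ultimately have "integrable M (\<lambda>\<omega>. X \<omega> * Y \<omega>)"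
    and prod: "(LINT \<omega>|M. X \<omega> * Y \<omega>) = (LINT \<omega>|M. X \<omega>) * (LINT \<omega>|M. Y \<omega>)"
    using int by (auto intro: indep_var_integrable indep_var_lebesgue_integral)
  then show "integrable M (\<lambda>\<omega>. X \<omega> * indicator {t} (\<tau> \<omega>))" by (simp add: Y_def)
  have "(LINT \<omega>|M. Y \<omega>) = (LINT \<omega>|M. indicator {\<omega> \<in> space M. \<tau> \<omega> = t} \<omega>)"
    by (intro Bochner_Integration.integral_cong) (auto simp: Y_def indicator_def)
  also have "\<dots> = prob {\<omega> \<in> space M. \<tau> \<omega> = t}"
    by simp (auto intro!: arg_cong[where f = prob])
  also have "\<dots> = \<eta>s t / (\<Sum>s=1..T. \<eta>s s)"
    using rr t by (simp add: randomized_reshuffling_def)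
  finally show "(LINT \<omega>|M. X \<omega> * indicator {t} (\<tau> \<omega>)) = (LINT \<omega>|M. X \<omega>) * (\<eta>s t / (\<Sum>s=1..T. \<eta>s s))"
    using prod by (simp add: Y_def)
qed

lemma integral_uniform_permutation:
  fixes h :: "(nat \<Rightarrow> nat) \<Rightarrow> real"
  assumes rr: "randomized_reshuffling M n T \<eta>s W0 \<pi> \<tau>" and t: "t \<in> {1..T}"
  shows "integrable M (\<lambda>\<omega>. h (\<pi> t \<omega>))"
    and "(LINT \<omega>|M. h (\<pi> t \<omega>)) = (\<Sum>p | p permutes {1..n}. h p) / fact n"
proof -
  let ?P = "{p. p permutes {1..n}}"
  have fin: "finite ?P" by (simp add: finite_permutations)
  have meas: "\<pi> t \<in> measurable M (count_space ?P)"
    and distr: "distr M (count_space ?P) (\<pi> t) = uniform_count_measure ?P"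
    using rr t by (auto simp: randomized_reshuffling_def)
  have "integrable (distr M (count_space ?P) (\<pi> t)) h"
    unfolding distr uniform_count_measure_def
    by (rule integrable_point_measure_finite[OF fin]) 
  then show "integrable M (\<lambda>\<omega>. h (\<pi> t \<omega>))"
    by (rule integrable_distr[OF meas])
  have "(LINT \<omega>|M. h (\<pi> t \<omega>)) = integral\<^sup>L (distr M (count_space ?P) (\<pi> t)) h"
    by (rule integral_distr[symmetric, OF meas]) simp
  also have "\<dots> = (\<Sum>p\<in>?P. h p) / card ?P"
    unfolding distr by (rule integral_uniform_count_measure[OF fin])
  also have "card ?P = fact n"
    by (rule card_permutations) simp_all
  finally show "(LINT \<omega>|M. h (\<pi> t \<omega>)) = (\<Sum>p | p permutes {1..n}. h p) / fact n"
    by simp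
qed

section \<open>Descent along a run\<close>

text \<open>Since every inner step uses the momentum \<open>m0\<close> of the previous epoch, the steps can be summed
  without unrolling a recursion for the momentum.\<close>

lemma smg_inner_closed_form:
  fixes p f \<beta> \<eta> n w0 m0
  defines "x \<equiv> \<lambda>i. fst (smg_inner n f \<beta> \<eta> p w0 m0 i)"
  defines "g \<equiv> \<lambda>i. grad (f (p (Suc i))) (x i)"
  shows "smg_inner n f \<beta> \<eta> p w0 m0 i =
    (w0 - (\<eta> / real n) *\<^sub>R ((real i * \<beta>) *\<^sub>R m0 + (1 - \<beta>) *\<^sub>R (\<Sum>j<i. g j)),
     (1 / real n) *\<^sub>R (\<Sum>j<i. g j))"
proof (induction i)
  case (Suc i)
  define X where "X = w0 - (\<eta> / real n) *\<^sub>R ((real i * \<beta>) *\<^sub>R m0 + (1 - \<beta>) *\<^sub>R (\<Sum>j<i. g j))"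
  have "smg_inner n f \<beta> \<eta> p w0 m0 i = (X, (1 / real n) *\<^sub>R (\<Sum>j<i. g j))"
    using Suc.IH by (simp only: X_def)
  moreover from this have "g i = grad (f (p (Suc i))) X"
    by (simp add: g_def x_def)
  ultimately have "smg_inner n f \<beta> \<eta> p w0 m0 (Suc i)
      = (X - (\<eta> / real n) *\<^sub>R (\<beta> *\<^sub>R m0 + (1 - \<beta>) *\<^sub>R g i),
         (1 / real n) *\<^sub>R (\<Sum>j<i. g j) + (1 / real n) *\<^sub>R g i)"
    by (simp add: Let_def)
  also have "X - (\<eta> / real n) *\<^sub>R (\<beta> *\<^sub>R m0 + (1 - \<beta>) *\<^sub>R g i)
      = w0 - (\<eta> / real n) *\<^sub>R ((real (Suc i) * \<beta>) *\<^sub>R m0 + (1 - \<beta>) *\<^sub>R (\<Sum>j<Suc i. g j))"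
    unfolding X_def sum.lessThan_Suc of_nat_Suc
    by (simp add: scaleR_add_right scaleR_add_left distrib_left distrib_right diff_diff_eq add_divide_distrib ac_simps)
  finally show ?case
    by (simp only: sum.lessThan_Suc scaleR_add_right)
qed simp

text \<open>The deterministic hypotheses for one constant learning rate. The bound on \<open>L * \<eta>\<close> is what
  remains of the learning rate condition of the theorem after \<open>sqrt (1 + \<beta>) \<ge> 1\<close>.\<close>

locale convex_smg =
  fixes n :: nat and L \<beta> \<eta> :: real and f :: "nat \<Rightarrow> 'a::euclidean_space \<Rightarrow> real" and wstar :: 'a
  assumes n_pos: "n \<ge> 1" and L_pos: "L > 0"
    and convex: "\<And>i. i \<in> {1..n} \<Longrightarrow> convex_on UNIV (f i)"
    and smooth: "\<And>i. i \<in> {1..n} \<Longrightarrow> L_smooth L (f i)"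
    and minimal: "minimizes (finite_sum_obj n f) wstar"
    and beta_nonneg: "0 \<le> \<beta>" and beta_less_1: "\<beta> < 1"
    and eta_pos: "\<eta> > 0" and eta_le: "L * \<eta> \<le> 1 / 2"
begin

definition gap :: "'a \<Rightarrow> real" where
  "gap w = finite_sum_obj n f w - finite_sum_obj n f wstar"

abbreviation noise :: "(nat \<Rightarrow> nat) \<Rightarrow> real" where
  "noise \<equiv> shuffling_noise n (\<lambda>i. grad (f i) wstar)"

lemma gap_nonneg: "gap w \<ge> 0"
  using minimal by (simp add: gap_def minimizes_def)

lemma gap_convex:
  assumes "0 \<le> t" "t \<le> 1"
  shows "gap (t *\<^sub>R a + (1 - t) *\<^sub>R b) \<le> t * gap a + (1 - t) * gap b"
proof -
  have "(\<Sum>i=1..n. f i (t *\<^sub>R a + (1 - t) *\<^sub>R b)) \<le> (\<Sum>i=1..n. t * f i a + (1 - t) * f i b)"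
  proof (rule sum_mono)
    fix i assume "i \<in> {1..n}"
    from convex_onD[OF convex[OF this], of "1 - t" a b] assms
    show "f i (t *\<^sub>R a + (1 - t) *\<^sub>R b) \<le> t * f i a + (1 - t) * f i b" by simp
  qed
  then have "finite_sum_obj n f (t *\<^sub>R a + (1 - t) *\<^sub>R b)
      \<le> (1 / real n) * (\<Sum>i=1..n. t * f i a + (1 - t) * f i b)"
    unfolding finite_sum_obj_def by (rule mult_left_mono) simp
  also have "\<dots> = t * finite_sum_obj n f a + (1 - t) * finite_sum_obj n f b"
    by (simp add: finite_sum_obj_def sum.distrib sum_distrib_left[symmetric] distrib_left
        add_divide_distrib)
  finally show ?thesis by (simp add: gap_def algebra_simps)
qed

lemma sum_grad_wstar: "(\<Sum>i=1..n. grad (f i) wstar) = 0"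
  using n_pos smooth minimal by (rule sum_grad_minimizer)

lemma sum_permuted:
  assumes "p permutes {1..n}"
  shows "(\<Sum>i<n. h (p (Suc i))) = (\<Sum>i=1..n. h i)"
proof -
  have "(\<Sum>i<n. h (p (Suc i))) = (\<Sum>i=1..n. h (p i))"
    by (simp add: sum.atLeast1_atMost_eq)
  also have "\<dots> = (\<Sum>i=1..n. h i)"
    using sum.permute[OF assms, of h] by (simp add: o_def)
  finally show ?thesis .
qed

text \<open>One epoch is seen from the auxiliary point \<open>z = w0 - (\<eta> * \<beta>) * m0\<close>, for which the momentum
  recursion becomes the plain step \<open>z - \<eta> * m'\<close>. Expanding the squared distance of this step to the
  minimizer, the three-point inequality bounds the inner product from below by the gap at \<open>z\<close>,
  plus the reserve \<open>G / (2 * L)\<close>, minus the mean squared drift of the inner iterates from \<open>z\<close>.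
  The drift is controlled by the old momentum, by \<open>G\<close> and by the shuffling noise. The old momentum
  is stored in the potential, and all terms with \<open>G\<close> together are nonpositive for
  \<open>L * \<eta> \<le> 1 / 2\<close>.\<close>

lemma epoch_inequality:
  assumes p: "p permutes {1..n}"
    and epoch: "smg_inner n f \<beta> \<eta> p w0 m0 n = (w', m')"
    and z_def: "z = w0 - (\<eta> * \<beta>) *\<^sub>R m0"
  shows "w' = z - (\<eta> * (1 - \<beta>)) *\<^sub>R m'"
    and "(norm (w' - (\<eta> * \<beta>) *\<^sub>R m' - wstar))\<^sup>2 + L * \<eta> ^ 3 * \<beta> * (norm m')\<^sup>2
      \<le> (norm (z - wstar))\<^sup>2 + L * \<eta> ^ 3 * \<beta> * (norm m0)\<^sup>2
        - 2 * \<eta> * gap z + 2 * (1 - \<beta>) * L * \<eta> ^ 3 * noise p"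
proof -
  define x where "x i = fst (smg_inner n f \<beta> \<eta> p w0 m0 i)" for i
  define g where "g i = grad (f (p (Suc i))) (x i)" for i
  define gs where "gs i = grad (f (p (Suc i))) wstar" for i
  \<comment> \<open>The mean squared deviation of the gradients in use from those at the
    minimizer.\<close>
  define G where "G = (\<Sum>i<n. (norm (g i - gs i))\<^sup>2) / real n"
  define N where "N = noise p"
  have npos: "real n > 0" using n_pos by simp
  have G0: "G \<ge> 0" unfolding G_def by (intro divide_nonneg_nonneg sum_nonneg) auto
  have sumG: "(\<Sum>i<n. (norm (g i - gs i))\<^sup>2) = real n * G"
    using npos by (simp add: G_def)
  have closed: "smg_inner n f \<beta> \<eta> p w0 m0 i =
    (w0 - (\<eta> / real n) *\<^sub>R ((real i * \<beta>) *\<^sub>R m0 + (1 - \<beta>) *\<^sub>R (\<Sum>j<i. g j)),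
     (1 / real n) *\<^sub>R (\<Sum>j<i. g j))" for i
    unfolding g_def x_def by (rule smg_inner_closed_form)
  have m': "m' = (1 / real n) *\<^sub>R (\<Sum>i<n. g i)"
    using closed[of n] epoch by simp
  have w': "w' = w0 - (\<eta> / real n) *\<^sub>R ((real n * \<beta>) *\<^sub>R m0 + (1 - \<beta>) *\<^sub>R (\<Sum>i<n. g i))"
    using closed[of n] epoch by simp
  have sum_g: "(\<Sum>i<n. g i) = real n *\<^sub>R m'"
    using npos by (simp add: m')
  show w'_z: "w' = z - (\<eta> * (1 - \<beta>)) *\<^sub>R m'"
    unfolding w' sum_g z_def using npos by (simp add: scaleR_add_right algebra_simps)
  have step: "w' - (\<eta> * \<beta>) *\<^sub>R m' = z - \<eta> *\<^sub>R m'"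
    unfolding w'_z by (simp add: algebra_simps)
  have sum_gs: "(\<Sum>i<n. gs i) = 0"
    using sum_permuted[OF p, of "\<lambda>i. grad (f i) wstar"] sum_grad_wstar by (simp add: gs_def)

  \<comment> \<open>The gradients at the minimizer add up to zero, so they may be subtracted
    before Jensen's inequality.\<close>
  have m'_le: "(norm m')\<^sup>2 \<le> G"
  proof -
    have "m' = (1 / real n) *\<^sub>R (\<Sum>i<n. g i - gs i)"
      by (simp add: m' sum_subtractf sum_gs)
    then have "(norm m')\<^sup>2 = (norm (\<Sum>i<n. g i - gs i))\<^sup>2 / (real n)\<^sup>2"
      by (simp add: power_mult_distrib power_divide)
    also have "\<dots> \<le> (real n * (real n * G)) / (real n)\<^sup>2"
      using norm_sum_squared_le[of "\<lambda>i. g i - gs i" "{..<n}"]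
      by (intro divide_right_mono) (simp_all add: sumG)
    also have "\<dots> = G" using npos by (simp add: power2_eq_square)
    finally show ?thesis .
  qed

  \<comment> \<open>Measured from \<open>z\<close>, the drift is a convex combination of a
    momentum part and a gradient part.\<close>
  have drift: "(norm (x i - z))\<^sup>2 \<le> \<eta>\<^sup>2 * (\<beta> * (norm m0)\<^sup>2
      + (1 - \<beta>) * (2 * (real i * G / real n) + 2 * ((norm (\<Sum>j<i. gs j))\<^sup>2 / (real n)\<^sup>2)))"
    if i: "i < n" for i
  proof -
    define a where "a = (\<eta> * (1 - real i / real n)) *\<^sub>R m0"
    define b where "b = (- (\<eta> / real n)) *\<^sub>R (\<Sum>j<i. g j)"
    have "x i - z = \<beta> *\<^sub>R a + (1 - \<beta>) *\<^sub>R b"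
      unfolding x_def closed z_def a_def b_def
      by (simp add: algebra_simps)
         (simp add: scaleR_add_left[symmetric] add_divide_distrib[symmetric])
    then have "(norm (x i - z))\<^sup>2 \<le> \<beta> * (norm a)\<^sup>2 + (1 - \<beta>) * (norm b)\<^sup>2"
      using norm_convex_combination_squared_le[of \<beta> a b] beta_nonneg beta_less_1 by simp
    moreover have "(norm a)\<^sup>2 \<le> \<eta>\<^sup>2 * (norm m0)\<^sup>2"
    proof -
      \<comment> \<open>The momentum is added in \<open>n\<close> equal portions, so its part
        shrinks from \<open>\<eta> * m0\<close> towards zero.\<close>
      have "(1 - real i / real n)\<^sup>2 \<le> 1\<^sup>2"
        using i by (intro power_mono) (auto simp: field_simps)
      then have "\<eta>\<^sup>2 * (norm m0)\<^sup>2 * (1 - real i / real n)\<^sup>2 \<le> \<eta>\<^sup>2 * (norm m0)\<^sup>2 * 1"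
        by (intro mult_left_mono) auto
      then show ?thesis
        by (simp add: a_def power_mult_distrib mult_ac)
    qed
    moreover have "(norm b)\<^sup>2 \<le> \<eta>\<^sup>2
        * (2 * (real i * G / real n) + 2 * ((norm (\<Sum>j<i. gs j))\<^sup>2 / (real n)\<^sup>2))"
    proof -
      have "(norm (\<Sum>j<i. g j))\<^sup>2 = (norm ((\<Sum>j<i. g j - gs j) + (\<Sum>j<i. gs j)))\<^sup>2"
        by (simp add: sum_subtractf)
      also have "\<dots> \<le> 2 * (norm (\<Sum>j<i. g j - gs j))\<^sup>2 + 2 * (norm (\<Sum>j<i. gs j))\<^sup>2"
        by (rule norm_add_squared_le)
      also have "(norm (\<Sum>j<i. g j - gs j))\<^sup>2 \<le> real i * (\<Sum>j<i. (norm (g j - gs j))\<^sup>2)"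
        using norm_sum_squared_le[of "\<lambda>j. g j - gs j" "{..<i}"] by simp
      also have "(\<Sum>j<i. (norm (g j - gs j))\<^sup>2) \<le> real n * G"
        unfolding sumG[symmetric] using i by (intro sum_mono2) auto
      finally have "(norm (\<Sum>j<i. g j))\<^sup>2
          \<le> 2 * (real i * (real n * G)) + 2 * (norm (\<Sum>j<i. gs j))\<^sup>2"
        by (simp add: mult_left_mono)
      then have "(\<eta>\<^sup>2 / (real n)\<^sup>2) * (norm (\<Sum>j<i. g j))\<^sup>2
          \<le> (\<eta>\<^sup>2 / (real n)\<^sup>2) * (2 * (real i * (real n * G)) + 2 * (norm (\<Sum>j<i. gs j))\<^sup>2)"
        by (intro mult_left_mono) auto
      also have "\<dots> = \<eta>\<^sup>2
          * (2 * (real i * G / real n) + 2 * ((norm (\<Sum>j<i. gs j))\<^sup>2 / (real n)\<^sup>2))"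
        using npos by (simp add: power2_eq_square field_simps)
      also have "(\<eta>\<^sup>2 / (real n)\<^sup>2) * (norm (\<Sum>j<i. g j))\<^sup>2 = (norm b)\<^sup>2"
        by (simp add: b_def power_mult_distrib power_divide)
      finally show ?thesis .
    qed
    ultimately have "(norm (x i - z))\<^sup>2 \<le> \<beta> * (\<eta>\<^sup>2 * (norm m0)\<^sup>2) + (1 - \<beta>) * (\<eta>\<^sup>2
        * (2 * (real i * G / real n) + 2 * ((norm (\<Sum>j<i. gs j))\<^sup>2 / (real n)\<^sup>2)))"
      using beta_nonneg beta_less_1 by (smt (verit) mult_left_mono)
    then show ?thesis by (simp only: distrib_left mult_ac)
  qed

  have mean_drift: "(\<Sum>i<n. (norm (x i - z))\<^sup>2)
      \<le> real n * (\<eta>\<^sup>2 * (\<beta> * (norm m0)\<^sup>2 + (1 - \<beta>) * (G + 2 * N)))"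
  proof -
    have "(\<Sum>i<n. (norm (x i - z))\<^sup>2) \<le> (\<Sum>i<n. \<eta>\<^sup>2 * (\<beta> * (norm m0)\<^sup>2
      + (1 - \<beta>) * (2 * (real i * G / real n) + 2 * ((norm (\<Sum>j<i. gs j))\<^sup>2 / (real n)\<^sup>2))))"
      by (rule sum_mono) (use drift in simp)
    also have "\<dots> = \<eta>\<^sup>2 * (real n * (\<beta> * (norm m0)\<^sup>2) + (1 - \<beta>)
        * (2 * ((\<Sum>i<n. real i) * G / real n) + 2 * ((\<Sum>i<n. (norm (\<Sum>j<i. gs j))\<^sup>2) / (real n)\<^sup>2)))"
      by (simp add: sum.distrib sum_distrib_left[symmetric] sum_distrib_right[symmetric]
          sum_divide_distrib[symmetric])
    also have "\<dots> \<le> \<eta>\<^sup>2 * (real n * (\<beta> * (norm m0)\<^sup>2) + (1 - \<beta>) * (real n * G + 2 * (real n * N)))"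
    proof -
      have "(\<Sum>i<n. real i) \<le> (real n)\<^sup>2 / 2"
        by (rule sum_lessThan_real_le)
      then have "(\<Sum>i<n. real i) * G / real n \<le> (real n)\<^sup>2 / 2 * G / real n"
        using G0 by (intro divide_right_mono mult_right_mono) auto
      also have "\<dots> = real n * G / 2" using npos by (simp add: power2_eq_square)
      finally have "2 * ((\<Sum>i<n. real i) * G / real n) \<le> real n * G" by linarith
      moreover have "(\<Sum>i<n. (norm (\<Sum>j<i. gs j))\<^sup>2) / (real n)\<^sup>2 = real n * N"
        using npos unfolding N_def shuffling_noise_def gs_def
        by (simp add: power2_eq_square power3_eq_cube)
      ultimately show ?thesis
        using beta_less_1 by (intro mult_left_mono add_left_mono) auto
    qed
    also have "\<dots> = real n * (\<eta>\<^sup>2 * (\<beta> * (norm m0)\<^sup>2 + (1 - \<beta>) * (G + 2 * N)))"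
      by (simp add: algebra_simps)
    finally show ?thesis .
  qed

  have descent: "m' \<bullet> (z - wstar)
      \<ge> gap z + G / (2 * L) - L / 2 * (\<eta>\<^sup>2 * (\<beta> * (norm m0)\<^sup>2 + (1 - \<beta>) * (G + 2 * N)))"
  proof -
    have fsum: "(\<Sum>i<n. f (p (Suc i)) v) = real n * finite_sum_obj n f v" for v
      using sum_permuted[OF p, of "\<lambda>i. f i v"] npos by (simp add: finite_sum_obj_def)
    have "(\<Sum>i<n. g i \<bullet> (z - wstar)) \<ge> (\<Sum>i<n. f (p (Suc i)) z - f (p (Suc i)) wstar
        + (norm (g i - gs i))\<^sup>2 / (2 * L) - L / 2 * (norm (x i - z))\<^sup>2)"
    proof (rule sum_mono)
      fix i assume "i \<in> {..<n}"
      then have "p (Suc i) \<in> {1..n}"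
        using permutes_in_image[OF p, of "Suc i"] by auto
      then show "f (p (Suc i)) z - f (p (Suc i)) wstar
        + (norm (g i - gs i))\<^sup>2 / (2 * L) - L / 2 * (norm (x i - z))\<^sup>2 \<le> g i \<bullet> (z - wstar)"
        unfolding g_def gs_def by (intro three_point_inequality convex smooth L_pos)
    qed
    also have "(\<Sum>i<n. f (p (Suc i)) z - f (p (Suc i)) wstar
        + (norm (g i - gs i))\<^sup>2 / (2 * L) - L / 2 * (norm (x i - z))\<^sup>2)
        = real n * gap z + real n * (G / (2 * L)) - L / 2 * (\<Sum>i<n. (norm (x i - z))\<^sup>2)"
      by (simp add: sum.distrib sum_subtractf sum_distrib_left[symmetric] fsum
          sum_divide_distrib[symmetric] sumG gap_def right_diff_distrib)
    also have "(\<Sum>i<n. g i \<bullet> (z - wstar)) = real n * (m' \<bullet> (z - wstar))"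
      by (simp add: inner_sum_left[symmetric] sum_g)
    finally have "real n * gap z + real n * (G / (2 * L)) - L / 2 * (\<Sum>i<n. (norm (x i - z))\<^sup>2)
        \<le> real n * (m' \<bullet> (z - wstar))" .
    moreover have "L / 2 * (\<Sum>i<n. (norm (x i - z))\<^sup>2)
        \<le> L / 2 * (real n * (\<eta>\<^sup>2 * (\<beta> * (norm m0)\<^sup>2 + (1 - \<beta>) * (G + 2 * N))))"
      using L_pos by (intro mult_left_mono mean_drift) simp
    ultimately have "real n * (gap z + G / (2 * L)
          - L / 2 * (\<eta>\<^sup>2 * (\<beta> * (norm m0)\<^sup>2 + (1 - \<beta>) * (G + 2 * N))))
        \<le> real n * (m' \<bullet> (z - wstar))"
      by (simp add: algebra_simps)
    then show ?thesis using npos by (simp only: mult_le_cancel_left_pos)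
  qed

  \<comment> \<open>This is the place where the bound on the learning rate enters.\<close>
  have coeff: "\<eta>\<^sup>2 * G + L * \<eta> ^ 3 * G \<le> \<eta> * G / L"
  proof -
    have "(L * \<eta>)\<^sup>2 \<le> (1 / 2)\<^sup>2"
      using eta_le L_pos eta_pos by (intro power_mono) auto
    then have "L * \<eta> + (L * \<eta>)\<^sup>2 \<le> 1"
      using eta_le by (simp add: power_divide)
    then have "(L * \<eta> + (L * \<eta>)\<^sup>2) * (\<eta> * G / L) \<le> 1 * (\<eta> * G / L)"
      using L_pos eta_pos G0 by (intro mult_right_mono) auto
    moreover have "(L * \<eta> + (L * \<eta>)\<^sup>2) * (\<eta> * G / L) = \<eta>\<^sup>2 * G + L * \<eta> ^ 3 * G"
      using L_pos by (simp add: power2_eq_square power3_eq_cube field_simps)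
    ultimately show ?thesis by simp
  qed

  have "(norm (w' - (\<eta> * \<beta>) *\<^sub>R m' - wstar))\<^sup>2
      = (norm (z - wstar))\<^sup>2 - 2 * \<eta> * (m' \<bullet> (z - wstar)) + \<eta>\<^sup>2 * (norm m')\<^sup>2"
    unfolding step power2_norm_eq_inner
    by (simp add: inner_diff_left inner_diff_right inner_commute power2_eq_square algebra_simps)
  also have "\<dots> \<le> (norm (z - wstar))\<^sup>2 - 2 * \<eta> * (gap z + G / (2 * L)
        - L / 2 * (\<eta>\<^sup>2 * (\<beta> * (norm m0)\<^sup>2 + (1 - \<beta>) * (G + 2 * N)))) + \<eta>\<^sup>2 * G"
    using descent m'_le eta_pos by (intro add_mono diff_mono mult_left_mono) auto
  also have "\<dots> = (norm (z - wstar))\<^sup>2 + L * \<eta> ^ 3 * \<beta> * (norm m0)\<^sup>2 - 2 * \<eta> * gap z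
        + 2 * (1 - \<beta>) * L * \<eta> ^ 3 * N
        + (\<eta>\<^sup>2 * G + L * \<eta> ^ 3 * G - \<eta> * G / L) - L * \<eta> ^ 3 * \<beta> * G"
  proof -
    have "2 * \<eta> * (G / (2 * L)) = \<eta> * G / L" by simp
    then show ?thesis
      by (simp only: right_diff_distrib distrib_left)
         (simp add: power2_eq_square power3_eq_cube algebra_simps)
  qed
  finally have "(norm (w' - (\<eta> * \<beta>) *\<^sub>R m' - wstar))\<^sup>2
      \<le> (norm (z - wstar))\<^sup>2 + L * \<eta> ^ 3 * \<beta> * (norm m0)\<^sup>2 - 2 * \<eta> * gap z
        + 2 * (1 - \<beta>) * L * \<eta> ^ 3 * N - L * \<eta> ^ 3 * \<beta> * G"
    using coeff by linarith
  moreover have "L * \<eta> ^ 3 * \<beta> * (norm m')\<^sup>2 \<le> L * \<eta> ^ 3 * \<beta> * G"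
    using L_pos eta_pos beta_nonneg m'_le by (intro mult_left_mono) auto
  ultimately show "(norm (w' - (\<eta> * \<beta>) *\<^sub>R m' - wstar))\<^sup>2 + L * \<eta> ^ 3 * \<beta> * (norm m')\<^sup>2
      \<le> (norm (z - wstar))\<^sup>2 + L * \<eta> ^ 3 * \<beta> * (norm m0)\<^sup>2
        - 2 * \<eta> * gap z + 2 * (1 - \<beta>) * L * \<eta> ^ 3 * noise p"
    unfolding N_def[symmetric] by linarith
qed


text \<open>Summing the epoch inequality telescopes the potential and bounds the gaps at the auxiliary
  points \<open>z t\<close>. The iterates are convex combinations of neighbouring auxiliary points, so
  convexity carries the bound over to them. Every single permutation sequence satisfies it.\<close>

lemma sum_gap_le:
  assumes p: "\<And>t. t \<in> {1..T} \<Longrightarrow> p t permutes {1..n}"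
  shows "2 * \<eta> * (1 - \<beta>) * (\<Sum>t<T. gap (smg_iterate n f \<beta> (\<lambda>_. \<eta>) p w0 t))
    \<le> (norm (w0 - wstar))\<^sup>2 + 2 * (1 - \<beta>) * L * \<eta> ^ 3 * (\<Sum>t=1..T. noise (p t))"
proof -
  define w where "w t = fst (smg n f \<beta> (\<lambda>_. \<eta>) p w0 t)" for t
  define m where "m t = snd (smg n f \<beta> (\<lambda>_. \<eta>) p w0 t)" for t
  define z where "z t = w t - (\<eta> * \<beta>) *\<^sub>R m t" for t
  define \<Phi> where "\<Phi> t = (norm (z t - wstar))\<^sup>2 + L * \<eta> ^ 3 * \<beta> * (norm (m t))\<^sup>2" for t
  define K where "K = 2 * (1 - \<beta>) * L * \<eta> ^ 3"
  have epoch: "smg_inner n f \<beta> \<eta> (p (Suc t)) (w t) (m t) n = (w (Suc t), m (Suc t))" for t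
    by (simp add: w_def m_def Let_def case_prod_beta)
  have start: "w 0 = w0" "m 0 = 0" "z 0 = w0"
    by (simp_all add: w_def m_def z_def)
  have decrease: "\<Phi> (Suc t) \<le> \<Phi> t - 2 * \<eta> * gap (z t) + K * noise (p (Suc t))" if "t < T" for t
    using epoch_inequality(2)[OF p epoch z_def, of t] that
    unfolding \<Phi>_def K_def z_def[of "Suc t"] by simp
  have telescope: "2 * \<eta> * (\<Sum>s<t. gap (z s)) + \<Phi> t \<le> \<Phi> 0 + K * (\<Sum>s=1..t. noise (p s))"
    if "t \<le> T" for t
    using that
  proof (induction t)
    case (Suc t)
    then show ?case using decrease[of t] by (simp add: distrib_left)
  qed simp
  have interpolate: "w (Suc t) = \<beta> *\<^sub>R z t + (1 - \<beta>) *\<^sub>R z (Suc t)" if "t < T" for t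
  proof -
    have "w (Suc t) = z t - (\<eta> * (1 - \<beta>)) *\<^sub>R m (Suc t)"
      using epoch_inequality(1)[OF p epoch z_def, of t] that by simp
    moreover from this have "z (Suc t) = z t - \<eta> *\<^sub>R m (Suc t)"
      unfolding z_def[of "Suc t"] by (simp add: algebra_simps)
    ultimately show ?thesis by (simp only:) (simp add: algebra_simps)
  qed
  \<comment> \<open>On the right of the interpolation, \<open>gap (z s)\<close> occurs with
    weight \<open>1 - \<beta>\<close> for \<open>w s\<close> and with weight
    \<open>\<beta>\<close> for \<open>w (Suc s)\<close>. Only \<open>gap (z 0)\<close> has the
    total weight \<open>1 + \<beta>\<close>, since \<open>w 0 = z 0\<close>; the factor
    \<open>1 - \<beta>\<close> on the left brings it down to at most \<open>1\<close>. The
    subtracted term reserves the weight that \<open>w (Suc t)\<close> puts on \<open>z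
    t\<close>.\<close>
  have shift: "(1 - \<beta>) * (\<Sum>s<Suc t. gap (w s)) \<le> (\<Sum>s<Suc t. gap (z s)) - \<beta> * gap (z t)"
    if "t < T" for t
    using that
  proof (induction t)
    case 0
    then show ?case by (simp add: start algebra_simps)
  next
    case (Suc t)
    have "(1 - \<beta>) * gap (w (Suc t)) \<le> (1 - \<beta>) * (\<beta> * gap (z t) + (1 - \<beta>) * gap (z (Suc t)))"
      using Suc.prems beta_nonneg beta_less_1
      by (subst interpolate) (auto intro!: mult_left_mono gap_convex)
    also have "\<dots> \<le> 1 * (\<beta> * gap (z t) + (1 - \<beta>) * gap (z (Suc t)))"
      using beta_nonneg beta_less_1 gap_nonneg by (intro mult_right_mono) auto
    finally have "(1 - \<beta>) * gap (w (Suc t)) \<le> \<beta> * gap (z t) + gap (z (Suc t)) - \<beta> * gap (z (Suc t))"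
      by (simp add: left_diff_distrib)
    moreover have "(1 - \<beta>) * (\<Sum>s<Suc t. gap (w s)) \<le> (\<Sum>s<Suc t. gap (z s)) - \<beta> * gap (z t)"
      using Suc by simp
    ultimately show ?case
      unfolding sum.lessThan_Suc[of _ "Suc t"] distrib_left[of "1 - \<beta>"] by linarith
  qed
  have "(1 - \<beta>) * (\<Sum>s<T. gap (w s)) \<le> (\<Sum>s<T. gap (z s))"
  proof (cases T)
    case (Suc t)
    then show ?thesis
      using shift[of t] mult_nonneg_nonneg[OF beta_nonneg gap_nonneg[of "z t"]] by simp
  qed simp
  then have "2 * \<eta> * ((1 - \<beta>) * (\<Sum>s<T. gap (w s))) \<le> 2 * \<eta> * (\<Sum>s<T. gap (z s))"
    using eta_pos by (intro mult_left_mono) auto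
  also have "\<dots> \<le> \<Phi> 0 + K * (\<Sum>s=1..T. noise (p s))"
  proof -
    have "\<Phi> T \<ge> 0"
      unfolding \<Phi>_def using L_pos eta_pos beta_nonneg by simp
    then show ?thesis using telescope[of T] by simp
  qed
  finally show ?thesis
    by (simp add: \<Phi>_def K_def start smg_iterate_def w_def mult.assoc)
qed

section \<open>Measurability and expectation\<close>

lemma borel_measurable_grad [measurable]:
  assumes "i \<in> {1..n}"
  shows "grad (f i) \<in> borel_measurable borel"
  by (rule borel_measurable_continuous_onI, rule continuous_on_grad, rule smooth[OF assms])

lemma borel_measurable_gap [measurable]: "gap \<in> borel_measurable borel"
proof (rule borel_measurable_continuous_onI)
  have "continuous_on UNIV (f i)" if "i \<in> {1..n}" for i
  proof -
    have "continuous (at x) (f i)" for x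
      using GDERIV_grad[OF smooth[OF that], of x] unfolding gderiv_def
      by (rule has_derivative_continuous)
    then show ?thesis by (simp add: continuous_on_eq_continuous_at)
  qed
  then show "continuous_on UNIV gap"
    unfolding gap_def finite_sum_obj_def by (intro continuous_intros) auto
qed

lemma borel_measurable_smg_inner:
  assumes p: "p permutes {1..n}"
    and W: "W \<in> borel_measurable N" and V: "V \<in> borel_measurable N" and "i \<le> n"
  shows "(\<lambda>\<omega>. fst (smg_inner n f \<beta> \<eta> p (W \<omega>) (V \<omega>) i)) \<in> borel_measurable N"
    and "(\<lambda>\<omega>. snd (smg_inner n f \<beta> \<eta> p (W \<omega>) (V \<omega>) i)) \<in> borel_measurable N"
  using \<open>i \<le> n\<close>
proof (induction i)
  case 0
  { case 1 then show ?case using W by simp }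
  { case 2 then show ?case by simp }
next
  case (Suc i)
  have "p (Suc i) \<in> {1..n}" if "Suc i \<le> n"
    using permutes_in_image[OF p, of "Suc i"] that by auto
  note g = borel_measurable_grad[OF this]
  { case 1
    then have [measurable]: "(\<lambda>\<omega>. grad (f (p (Suc i))) (fst (smg_inner n f \<beta> \<eta> p (W \<omega>) (V \<omega>) i))) \<in> borel_measurable N"
      by (intro measurable_compose[OF _ g] Suc) auto
    have [measurable]: "(\<lambda>\<omega>. fst (smg_inner n f \<beta> \<eta> p (W \<omega>) (V \<omega>) i)) \<in> borel_measurable N"
      using 1 by (intro Suc) auto
    show ?case using V by (simp add: Let_def case_prod_beta) }
  { case 2
    then have [measurable]: "(\<lambda>\<omega>. grad (f (p (Suc i))) (fst (smg_inner n f \<beta> \<eta> p (W \<omega>) (V \<omega>) i))) \<in> borel_measurable N"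
      by (intro measurable_compose[OF _ g] Suc) auto
    have [measurable]: "(\<lambda>\<omega>. snd (smg_inner n f \<beta> \<eta> p (W \<omega>) (V \<omega>) i)) \<in> borel_measurable N"
      using 2 by (intro Suc) auto
    show ?case by (simp add: Let_def case_prod_beta) }
qed

text \<open>The random permutation takes finitely many values, so it can be treated as fixed within
  one epoch.\<close>

lemma borel_measurable_smg:
  assumes W0: "W0 \<in> borel_measurable N"
    and \<pi>: "\<And>t. t \<in> {1..T} \<Longrightarrow> \<pi> t \<in> measurable N (count_space {p. p permutes {1..n}})"
    and "t \<le> T"
  shows "(\<lambda>\<omega>. fst (smg n f \<beta> (\<lambda>_. \<eta>) (\<lambda>t. \<pi> t \<omega>) (W0 \<omega>) t)) \<in> borel_measurable N"
    and "(\<lambda>\<omega>. snd (smg n f \<beta> (\<lambda>_. \<eta>) (\<lambda>t. \<pi> t \<omega>) (W0 \<omega>) t)) \<in> borel_measurable N"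
  using \<open>t \<le> T\<close>
proof (induction t)
  case 0
  { case 1 then show ?case using W0 by simp }
  { case 2 then show ?case by simp }
next
  case (Suc t)
  have countable: "countable {p. p permutes {1..n}}"
    by (intro countable_finite finite_permutations) simp
  { case 1
    have "(\<lambda>\<omega>. (\<lambda>p \<omega>. fst (smg_inner n f \<beta> \<eta> p (fst (smg n f \<beta> (\<lambda>_. \<eta>) (\<lambda>t. \<pi> t \<omega>) (W0 \<omega>) t))
        (snd (smg n f \<beta> (\<lambda>_. \<eta>) (\<lambda>t. \<pi> t \<omega>) (W0 \<omega>) t)) n)) (\<pi> (Suc t) \<omega>) \<omega>) \<in> borel_measurable N"
      by (rule measurable_compose_countable'[OF _ \<pi> countable])
         (use 1 in \<open>auto intro!: borel_measurable_smg_inner Suc\<close>)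
    then show ?case by (simp add: Let_def case_prod_beta) }
  { case 2
    have "(\<lambda>\<omega>. (\<lambda>p \<omega>. snd (smg_inner n f \<beta> \<eta> p (fst (smg n f \<beta> (\<lambda>_. \<eta>) (\<lambda>t. \<pi> t \<omega>) (W0 \<omega>) t))
        (snd (smg n f \<beta> (\<lambda>_. \<eta>) (\<lambda>t. \<pi> t \<omega>) (W0 \<omega>) t)) n)) (\<pi> (Suc t) \<omega>) \<omega>) \<in> borel_measurable N"
      by (rule measurable_compose_countable'[OF _ \<pi> countable])
         (use 2 in \<open>auto intro!: borel_measurable_smg_inner Suc\<close>)
    then show ?case by (simp add: Let_def case_prod_beta) }
qed


text \<open>The pathwise bound is averaged over the initial point and over the permutations, each of which
  contributes the mean shuffling noise. The same bound dominates every single gap, so it also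
  yields integrability.\<close>

lemma expected_gap_le:
  fixes M :: "'w measure"
  assumes rr: "randomized_reshuffling M n T (\<lambda>_. \<eta>) W0 \<pi> \<tau>" and T: "T \<ge> 1"
    and int: "integrable M (\<lambda>\<omega>. (norm (W0 \<omega> - wstar))\<^sup>2)"
  shows "integrable M (\<lambda>\<omega>. gap (smg_output n f \<beta> (\<lambda>_. \<eta>) W0 \<pi> \<tau> \<omega>))"
    and "(LINT \<omega>|M. gap (smg_output n f \<beta> (\<lambda>_. \<eta>) W0 \<pi> \<tau> \<omega>))
      \<le> (LINT \<omega>|M. (norm (W0 \<omega> - wstar))\<^sup>2) / (2 * \<eta> * (1 - \<beta>) * real T)
        + L * \<eta>\<^sup>2 * grad_variance n f wstar / (2 * real n)"
proof -
  interpret prob_space M using rr by (simp add: randomized_reshuffling_def)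
  define X where "X t \<omega> = gap (smg_iterate n f \<beta> (\<lambda>_. \<eta>) (\<lambda>t. \<pi> t \<omega>) (W0 \<omega>) t)" for t \<omega>
  define c where "c = 2 * \<eta> * (1 - \<beta>)"
  define K where "K = 2 * (1 - \<beta>) * L * \<eta> ^ 3"
  define B where "B \<omega> = (norm (W0 \<omega> - wstar))\<^sup>2 + K * (\<Sum>t=1..T. noise (\<pi> t \<omega>))" for \<omega>
  have c: "c > 0" using eta_pos beta_less_1 by (simp add: c_def)
  have W0_meas: "W0 \<in> borel_measurable M"
    and \<tau>_meas: "\<tau> \<in> measurable M (count_space {1..T})"
    and \<pi>_meas: "\<And>t. t \<in> {1..T} \<Longrightarrow> \<pi> t \<in> measurable M (count_space {p. p permutes {1..n}})"
    using rr unfolding randomized_reshuffling_def by blast+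
  have perm: "\<pi> t \<in> space M \<rightarrow> {p. p permutes {1..n}}" if "t \<in> {1..T}" for t
    using measurable_space[OF \<pi>_meas[OF that]] by auto
  have \<tau>_range: "\<tau> \<omega> \<in> {1..T}" if "\<omega> \<in> space M" for \<omega>
    using measurable_space[OF \<tau>_meas that] by simp
  have X_nonneg: "X t \<omega> \<ge> 0" for t \<omega>
    by (simp add: X_def gap_nonneg)
  have pathwise: "c * (\<Sum>t<T. X t \<omega>) \<le> B \<omega>" if "\<omega> \<in> space M" for \<omega>
    unfolding X_def B_def c_def K_def
    by (rule sum_gap_le) (use perm that in auto)
  have X_meas: "X t \<in> borel_measurable (input_algebra M n T W0 \<pi>)" if "t \<le> T" for t
    unfolding X_def smg_iterate_def
    by (intro measurable_compose[OF _ borel_measurable_gap]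
        borel_measurable_smg(1)[OF measurable_input_init measurable_input_perm that] perm)
  have X_measM: "X t \<in> borel_measurable M" if "t \<le> T" for t
    unfolding X_def smg_iterate_def
    by (intro measurable_compose[OF _ borel_measurable_gap]
        borel_measurable_smg(1)[OF W0_meas \<pi>_meas that])
  have int_noise: "integrable M (\<lambda>\<omega>. noise (\<pi> t \<omega>))" if "t \<in> {1..T}" for t
    by (rule integral_uniform_permutation(1)[OF rr that])
  have int_B: "integrable M B"
    unfolding B_def
    by (intro Bochner_Integration.integrable_add int Bochner_Integration.integrable_sum
        integrable_mult_right int_noise)
  have int_X: "integrable M (X t)" if "t < T" for t
  proof (rule Bochner_Integration.integrable_bound)
    show "integrable M (\<lambda>\<omega>. B \<omega> / c)" using int_B by simp
    show "X t \<in> borel_measurable M" using that by (intro X_measM) simp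
    show "AE \<omega> in M. norm (X t \<omega>) \<le> norm (B \<omega> / c)"
    proof (rule AE_I2)
      fix \<omega> assume \<omega>: "\<omega> \<in> space M"
      have "X t \<omega> \<le> (\<Sum>t<T. X t \<omega>)"
        using that X_nonneg by (intro member_le_sum) auto
      also have "\<dots> \<le> B \<omega> / c"
        using pathwise[OF \<omega>] c by (simp add: pos_le_divide_eq mult.commute)
      finally show "norm (X t \<omega>) \<le> norm (B \<omega> / c)"
        unfolding real_norm_def using X_nonneg[of t \<omega>] by linarith
    qed
  qed

  \<comment> \<open>The output index \<open>Suc t\<close> selects the iterate after
    \<open>t\<close> epochs.\<close>
  have at_output: "gap (smg_output n f \<beta> (\<lambda>_. \<eta>) W0 \<pi> \<tau> \<omega>)
      = (\<Sum>t<T. X t \<omega> * indicator {Suc t} (\<tau> \<omega>))" if \<omega>: "\<omega> \<in> space M" for \<omega>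
  proof -
    have "(\<Sum>t<T. X t \<omega> * indicator {Suc t} (\<tau> \<omega>)) = (\<Sum>t<T. if t = \<tau> \<omega> - 1 then X t \<omega> else 0)"
      using \<tau>_range[OF \<omega>] by (intro sum.cong) (auto simp: indicator_def)
    also have "\<dots> = X (\<tau> \<omega> - 1) \<omega>"
      using \<tau>_range[OF \<omega>] by (subst sum.delta) auto
    finally show ?thesis by (simp add: X_def smg_output_def)
  qed
  have weight: "\<eta> / (\<Sum>s=1..T. \<eta>) = 1 / real T"
    using eta_pos T by simp
  have int_term: "integrable M (\<lambda>\<omega>. X t \<omega> * indicator {Suc t} (\<tau> \<omega>))"
    and expect_term: "(LINT \<omega>|M. X t \<omega> * indicator {Suc t} (\<tau> \<omega>)) = (LINT \<omega>|M. X t \<omega>) / real T"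
    if "t < T" for t
    using expectation_output_indicator[OF rr X_meas int_X, of t "Suc t"] that weight by auto
  have "integrable M (\<lambda>\<omega>. \<Sum>t<T. X t \<omega> * indicator {Suc t} (\<tau> \<omega>))"
    by (intro Bochner_Integration.integrable_sum int_term) simp
  then show "integrable M (\<lambda>\<omega>. gap (smg_output n f \<beta> (\<lambda>_. \<eta>) W0 \<pi> \<tau> \<omega>))"
    by (subst Bochner_Integration.integrable_cong[OF refl at_output])

  have "(LINT \<omega>|M. gap (smg_output n f \<beta> (\<lambda>_. \<eta>) W0 \<pi> \<tau> \<omega>))
      = (LINT \<omega>|M. (\<Sum>t<T. X t \<omega> * indicator {Suc t} (\<tau> \<omega>)))"
    by (rule Bochner_Integration.integral_cong[OF refl at_output])
  also have "\<dots> = (\<Sum>t<T. (LINT \<omega>|M. X t \<omega>) / real T)"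
    using int_term expect_term by (subst Bochner_Integration.integral_sum) auto
  also have "\<dots> = (LINT \<omega>|M. (\<Sum>t<T. X t \<omega>)) / real T"
    using int_X by (subst Bochner_Integration.integral_sum) (auto simp: sum_divide_distrib)
  also have "\<dots> \<le> (LINT \<omega>|M. B \<omega> / c) / real T"
  proof (intro divide_right_mono integral_mono)
    show "integrable M (\<lambda>\<omega>. \<Sum>t<T. X t \<omega>)"
      using int_X by (intro Bochner_Integration.integrable_sum) auto
    show "integrable M (\<lambda>\<omega>. B \<omega> / c)" using int_B by simp
    show "(\<Sum>t<T. X t \<omega>) \<le> B \<omega> / c" if "\<omega> \<in> space M" for \<omega>
      using pathwise[OF that] c by (simp add: pos_le_divide_eq mult.commute)
  qed simp
  also have "(LINT \<omega>|M. B \<omega> / c) = (LINT \<omega>|M. B \<omega>) / c" by simp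
  also have "(LINT \<omega>|M. B \<omega>)
      = (LINT \<omega>|M. (norm (W0 \<omega> - wstar))\<^sup>2) + K * (\<Sum>t=1..T. LINT \<omega>|M. noise (\<pi> t \<omega>))"
    unfolding B_def using int int_noise
    by (subst Bochner_Integration.integral_add)
       (auto intro!: Bochner_Integration.integrable_sum Bochner_Integration.integral_sum)
  also have "((LINT \<omega>|M. (norm (W0 \<omega> - wstar))\<^sup>2) + K * (\<Sum>t=1..T. LINT \<omega>|M. noise (\<pi> t \<omega>))) / c / real T
     \<le> ((LINT \<omega>|M. (norm (W0 \<omega> - wstar))\<^sup>2)
        + K * (real T * (grad_variance n f wstar / (2 * real n)))) / c / real T"
  proof -
    have "(LINT \<omega>|M. noise (\<pi> t \<omega>)) \<le> grad_variance n f wstar / (2 * real n)" if "t \<in> {1..T}" for t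
      using shuffling_noise_average[OF n_pos sum_grad_wstar]
      unfolding integral_uniform_permutation(2)[OF rr that] grad_variance_def by simp
    then have "(\<Sum>t=1..T. LINT \<omega>|M. noise (\<pi> t \<omega>))
        \<le> (\<Sum>t=1..T. grad_variance n f wstar / (2 * real n))"
      by (rule sum_mono)
    then have "(\<Sum>t=1..T. LINT \<omega>|M. noise (\<pi> t \<omega>)) \<le> real T * (grad_variance n f wstar / (2 * real n))"
      by simp
    moreover have "K \<ge> 0" using L_pos eta_pos beta_less_1 by (simp add: K_def)
    ultimately show ?thesis
      using c by (intro divide_right_mono add_left_mono mult_left_mono) auto
  qed
  also have "\<dots> = (LINT \<omega>|M. (norm (W0 \<omega> - wstar))\<^sup>2) / (c * real T)
        + (K / c) * (grad_variance n f wstar / (2 * real n))"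
    using T by (simp add: add_divide_distrib)
  also have "K / c = L * \<eta>\<^sup>2"
    using eta_pos beta_less_1 by (simp add: K_def c_def power2_eq_square power3_eq_cube)
  finally show "(LINT \<omega>|M. gap (smg_output n f \<beta> (\<lambda>_. \<eta>) W0 \<pi> \<tau> \<omega>))
      \<le> (LINT \<omega>|M. (norm (W0 \<omega> - wstar))\<^sup>2) / (2 * \<eta> * (1 - \<beta>) * real T)
        + L * \<eta>\<^sup>2 * grad_variance n f wstar / (2 * real n)"
    by (simp add: c_def)
qed

end

section \<open>The learning rate and the convergence rate\<close>

lemma grad_variance_nonneg: "grad_variance n f w \<ge> 0"
  unfolding grad_variance_def by (intro mult_nonneg_nonneg sum_nonneg) auto

text \<open>The two error terms, of order \<open>1 / (\<eta> * T)\<close> and \<open>\<eta>\<^sup>2 / n\<close>, are balanced by this learning rate: both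
  become multiples of the same \<open>r\<close>.\<close>

lemma const_rate_identities:
  assumes "n \<ge> 1" "T \<ge> 1"
  defines "r \<equiv> 1 / (real n powr (1/3) * real T powr (2/3))"
  shows "const_rate \<gamma> n T t * real T * r = \<gamma>"
    and "(const_rate \<gamma> n T t)\<^sup>2 / real n = \<gamma>\<^sup>2 * r"
proof -
  define a where "a = real n powr (1/3)"
  define b where "b = real T powr (1/3)"
  have pos: "a > 0" "b > 0" using assms(1,2) by (simp_all add: a_def b_def)
  have n: "real n = a ^ 3"
    using assms(1) by (simp add: a_def powr_realpow[symmetric] powr_powr)
  have T: "real T = b ^ 3"
    using assms(2) by (simp add: b_def powr_realpow[symmetric] powr_powr)
  have "real T powr (2/3) = b\<^sup>2"
    using assms(2) by (simp add: b_def powr_realpow[symmetric] powr_powr)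
  then have r: "r = 1 / (a * b\<^sup>2)" by (simp add: r_def a_def)
  have rate: "const_rate \<gamma> n T t = \<gamma> * a / b"
    by (simp add: const_rate_def a_def b_def)
  show "const_rate \<gamma> n T t * real T * r = \<gamma>"
    unfolding rate r T using pos by (simp add: power2_eq_square power3_eq_cube)
  show "(const_rate \<gamma> n T t)\<^sup>2 / real n = \<gamma>\<^sup>2 * r"
    unfolding rate r n using pos by (simp add: power2_eq_square power3_eq_cube)
qed

lemma rate_le_half_inverse_smoothness:
  fixes L \<beta> \<eta> :: real
  assumes "L > 0" "0 \<le> \<beta>" "\<eta> \<le> 1 / (2 * L * sqrt (1 + \<beta>))"
  shows "L * \<eta> \<le> 1 / 2"
proof -
  have "sqrt (1 + \<beta>) \<ge> 1" using assms by simp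
  then have "1 / (2 * L * sqrt (1 + \<beta>)) \<le> 1 / (2 * L * 1)"
    using assms by (intro divide_left_mono mult_left_mono mult_pos_pos) auto
  then have "L * \<eta> \<le> L * (1 / (2 * L))"
    using assms by (intro mult_left_mono) auto
  then show ?thesis using assms by simp
qed

lemma smg_gap_bound:
  fixes f :: "nat \<Rightarrow> 'a::euclidean_space \<Rightarrow> real"
  assumes "L > 0" "0 \<le> \<beta>" "\<beta> < 1" "\<gamma> > 0"
    and S: "smg_rr_setting L \<beta> \<gamma> n T f wstar M W0 \<pi> \<tau>"
  shows "integrable M (smg_gap \<beta> \<gamma> n T f wstar W0 \<pi> \<tau>)"
    and "(LINT \<omega>|M. smg_gap \<beta> \<gamma> n T f wstar W0 \<pi> \<tau> \<omega>)
            \<le> 1 / (real n powr (1/3) * real T powr (2/3)) *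
               ((LINT \<omega>|M. (norm (W0 \<omega> - wstar))\<^sup>2) / (2 * (1 - \<beta>) * \<gamma>)
                + 4 * L * grad_variance n f wstar * (1 + \<beta>) * \<gamma>\<^sup>2 / (6 * (1 - \<beta>)))"
    and "smg_gap \<beta> \<gamma> n T f wstar W0 \<pi> \<tau> \<omega> \<ge> 0"
proof -
  define \<eta> where "\<eta> = const_rate \<gamma> n T 0"
  define r where "r = 1 / (real n powr (1/3) * real T powr (2/3))"
  define D where "D = (LINT \<omega>|M. (norm (W0 \<omega> - wstar))\<^sup>2)"
  define V where "V = grad_variance n f wstar"
  have const: "const_rate \<gamma> n T = (\<lambda>_. \<eta>)"
    by (simp add: fun_eq_iff \<eta>_def const_rate_def)
  have n: "n \<ge> 1" and T: "T \<ge> 1" using S by (simp_all add: smg_rr_setting_def)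
  have \<eta>: "\<eta> > 0" using n T assms(4) by (simp add: \<eta>_def const_rate_def)
  have "\<eta> \<le> 1 / (2 * L * sqrt (1 + \<beta>))"
    using S by (simp add: smg_rr_setting_def \<eta>_def const_rate_def)
  then have \<eta>_le: "L * \<eta> \<le> 1 / 2"
    using assms by (intro rate_le_half_inverse_smoothness)
  interpret convex_smg n L \<beta> \<eta> f wstar
    by unfold_locales (use S assms \<eta> \<eta>_le in \<open>auto simp: smg_rr_setting_def\<close>)
  have gap: "smg_gap \<beta> \<gamma> n T f wstar W0 \<pi> \<tau> = (\<lambda>\<omega>. gap (smg_output n f \<beta> (\<lambda>_. \<eta>) W0 \<pi> \<tau> \<omega>))"
    by (simp add: fun_eq_iff smg_gap_def gap_def const)
  have rr: "randomized_reshuffling M n T (\<lambda>_. \<eta>) W0 \<pi> \<tau>"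
    and int: "integrable M (\<lambda>\<omega>. (norm (W0 \<omega> - wstar))\<^sup>2)"
    using S by (simp_all add: smg_rr_setting_def const)
  show "integrable M (smg_gap \<beta> \<gamma> n T f wstar W0 \<pi> \<tau>)"
    unfolding gap by (rule expected_gap_le(1)[OF rr T int])
  show "smg_gap \<beta> \<gamma> n T f wstar W0 \<pi> \<tau> \<omega> \<ge> 0"
    by (simp add: gap gap_nonneg)
  have \<gamma>: "\<eta> * real T * r = \<gamma>" and rate: "\<eta>\<^sup>2 / real n = \<gamma>\<^sup>2 * r"
    unfolding \<eta>_def r_def by (rule const_rate_identities[OF n T])+
  have r_pos: "r > 0" using n T by (simp add: r_def)
  have "(LINT \<omega>|M. smg_gap \<beta> \<gamma> n T f wstar W0 \<pi> \<tau> \<omega>)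
      \<le> D / (2 * \<eta> * (1 - \<beta>) * real T) + L * \<eta>\<^sup>2 * V / (2 * real n)"
    unfolding gap D_def V_def by (rule expected_gap_le(2)[OF rr T int])
  also have "D / (2 * \<eta> * (1 - \<beta>) * real T) = r * (D / (2 * (1 - \<beta>) * \<gamma>))"
    unfolding \<gamma>[symmetric] using \<eta> r_pos T beta_less_1 by simp
  also have "L * \<eta>\<^sup>2 * V / (2 * real n) = r * (L * V * \<gamma>\<^sup>2 * (1 / 2))"
    using arg_cong[OF rate, of "\<lambda>x. L * V / 2 * x"] by (simp add: mult_ac)
  also have "r * (L * V * \<gamma>\<^sup>2 * (1 / 2)) \<le> r * (L * V * \<gamma>\<^sup>2 * (4 * (1 + \<beta>) / (6 * (1 - \<beta>))))"
  proof -
    \<comment> \<open>The right-hand side increases with \<open>\<beta>\<close> and equals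
      \<open>2 / 3\<close> at \<open>\<beta> = 0\<close>.\<close>
    have "1 / 2 \<le> 4 * (1 + \<beta>) / (6 * (1 - \<beta>))"
      using beta_nonneg beta_less_1 by (simp add: pos_le_divide_eq)
    then show ?thesis
      using r_pos L_pos grad_variance_nonneg[of n f wstar]
      by (intro mult_left_mono) (auto simp: V_def)
  qed
  finally show "(LINT \<omega>|M. smg_gap \<beta> \<gamma> n T f wstar W0 \<pi> \<tau> \<omega>)
            \<le> 1 / (real n powr (1/3) * real T powr (2/3)) *
               ((LINT \<omega>|M. (norm (W0 \<omega> - wstar))\<^sup>2) / (2 * (1 - \<beta>) * \<gamma>)
                + 4 * L * grad_variance n f wstar * (1 + \<beta>) * \<gamma>\<^sup>2 / (6 * (1 - \<beta>)))"
    unfolding r_def[symmetric] D_def[symmetric] V_def[symmetric]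
    by (simp add: distrib_left mult_ac)
qed

theorem corollary1:
  fixes L \<beta> \<gamma> :: real
  assumes "L > 0" and "0 \<le> \<beta>" and "\<beta> < 1" and "\<gamma> > 0"
  shows
    "(\<forall>n T (f :: nat \<Rightarrow> real ^ 'd \<Rightarrow> real) wstar (M :: 'w measure) W0 \<pi> \<tau>.
        smg_rr_setting L \<beta> \<gamma> n T f wstar M W0 \<pi> \<tau> \<longrightarrow>
          integrable M (smg_gap \<beta> \<gamma> n T f wstar W0 \<pi> \<tau>) \<and>
          (LINT \<omega>|M. smg_gap \<beta> \<gamma> n T f wstar W0 \<pi> \<tau> \<omega>)
            \<le> 1 / (real n powr (1/3) * real T powr (2/3)) *
               ((LINT \<omega>|M. (norm (W0 \<omega> - wstar))\<^sup>2) / (2 * (1 - \<beta>) * \<gamma>)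
                + 4 * L * grad_variance n f wstar * (1 + \<beta>) * \<gamma>\<^sup>2 / (6 * (1 - \<beta>))))
     \<and>
     (\<forall>D S :: real. \<exists>C > 0.
        \<forall>n T (f :: nat \<Rightarrow> real ^ 'd \<Rightarrow> real) wstar (M :: 'w measure) W0 \<pi> \<tau>.
          smg_rr_setting L \<beta> \<gamma> n T f wstar M W0 \<pi> \<tau> \<and>
          (LINT \<omega>|M. (norm (W0 \<omega> - wstar))\<^sup>2) \<le> D \<and> grad_variance n f wstar \<le> S \<longrightarrow>
          \<bar>LINT \<omega>|M. smg_gap \<beta> \<gamma> n T f wstar W0 \<pi> \<tau> \<omega>\<bar>
            \<le> C * (1 / (real n powr (1/3) * real T powr (2/3))))"
proof (intro conjI allI impI)
  fix n T and f :: "nat \<Rightarrow> real ^ 'd \<Rightarrow> real" and wstar and M :: "'w measure" and W0 \<pi> \<tau>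
  assume S: "smg_rr_setting L \<beta> \<gamma> n T f wstar M W0 \<pi> \<tau>"
  show "integrable M (smg_gap \<beta> \<gamma> n T f wstar W0 \<pi> \<tau>)"
    by (rule smg_gap_bound(1)[OF assms S])
  show "(LINT \<omega>|M. smg_gap \<beta> \<gamma> n T f wstar W0 \<pi> \<tau> \<omega>)
            \<le> 1 / (real n powr (1/3) * real T powr (2/3)) *
               ((LINT \<omega>|M. (norm (W0 \<omega> - wstar))\<^sup>2) / (2 * (1 - \<beta>) * \<gamma>)
                + 4 * L * grad_variance n f wstar * (1 + \<beta>) * \<gamma>\<^sup>2 / (6 * (1 - \<beta>)))"
    by (rule smg_gap_bound(2)[OF assms S])
next
  fix D S :: real
  \<comment> \<open>The summand \<open>1\<close> makes \<open>C\<close> positive when \<open>D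
    = S = 0\<close>.\<close>
  define C where "C = \<bar>D\<bar> / (2 * (1 - \<beta>) * \<gamma>) + 4 * L * \<bar>S\<bar> * (1 + \<beta>) * \<gamma>\<^sup>2 / (6 * (1 - \<beta>)) + 1"
  have "C > 0"
    unfolding C_def using assms by (intro add_nonneg_pos add_nonneg_nonneg divide_nonneg_pos) auto
  moreover have "\<bar>LINT \<omega>|M. smg_gap \<beta> \<gamma> n T f wstar W0 \<pi> \<tau> \<omega>\<bar>
      \<le> C * (1 / (real n powr (1/3) * real T powr (2/3)))"
    if "smg_rr_setting L \<beta> \<gamma> n T f wstar M W0 \<pi> \<tau> \<and>
      (LINT \<omega>|M. (norm (W0 \<omega> - wstar))\<^sup>2) \<le> D \<and> grad_variance n f wstar \<le> S"
    for n T and f :: "nat \<Rightarrow> real ^ 'd \<Rightarrow> real" and wstar and M :: "'w measure" and W0 \<pi> \<tau>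
  proof -
    from that have setting: "smg_rr_setting L \<beta> \<gamma> n T f wstar M W0 \<pi> \<tau>"
      and D: "(LINT \<omega>|M. (norm (W0 \<omega> - wstar))\<^sup>2) \<le> \<bar>D\<bar>"
      and S: "grad_variance n f wstar \<le> \<bar>S\<bar>" by auto
    define r where "r = 1 / (real n powr (1/3) * real T powr (2/3))"
    have r: "r \<ge> 0" by (simp add: r_def)
    have "\<bar>LINT \<omega>|M. smg_gap \<beta> \<gamma> n T f wstar W0 \<pi> \<tau> \<omega>\<bar> = (LINT \<omega>|M. smg_gap \<beta> \<gamma> n T f wstar W0 \<pi> \<tau> \<omega>)"
      by (intro abs_of_nonneg Bochner_Integration.integral_nonneg smg_gap_bound(3)[OF assms setting])
    also have "\<dots> \<le> r * ((LINT \<omega>|M. (norm (W0 \<omega> - wstar))\<^sup>2) / (2 * (1 - \<beta>) * \<gamma>)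
                + 4 * L * grad_variance n f wstar * (1 + \<beta>) * \<gamma>\<^sup>2 / (6 * (1 - \<beta>)))"
      unfolding r_def by (rule smg_gap_bound(2)[OF assms setting])
    also have "\<dots> \<le> r * (\<bar>D\<bar> / (2 * (1 - \<beta>) * \<gamma>) + 4 * L * \<bar>S\<bar> * (1 + \<beta>) * \<gamma>\<^sup>2 / (6 * (1 - \<beta>)))"
      using assms D S r
      by (intro mult_left_mono add_mono divide_right_mono mult_right_mono) auto
    also have "\<dots> \<le> r * C"
      using r by (intro mult_left_mono) (auto simp: C_def)
    finally show ?thesis by (simp add: r_def mult.commute)
  qed
  ultimately show "\<exists>C > 0.
        \<forall>n T (f :: nat \<Rightarrow> real ^ 'd \<Rightarrow> real) wstar (M :: 'w measure) W0 \<pi> \<tau>.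
          smg_rr_setting L \<beta> \<gamma> n T f wstar M W0 \<pi> \<tau> \<and>
          (LINT \<omega>|M. (norm (W0 \<omega> - wstar))\<^sup>2) \<le> D \<and> grad_variance n f wstar \<le> S \<longrightarrow>
          \<bar>LINT \<omega>|M. smg_gap \<beta> \<gamma> n T f wstar W0 \<pi> \<tau> \<omega>\<bar>
            \<le> C * (1 / (real n powr (1/3) * real T powr (2/3)))"
    by blast
qed

end
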